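(* Let $(\{z_t^{(j)}\}_{j=1}^J)_{t\ge0}$ be generated by the dynamic ensemble Kalman inversion (DEKI) described in the context, with constant step size $\eta_t=h>0$ and an initial ensemble such that $C_0^{zz}\succ\sigma_lI$ almost surely for some $\sigma_l>0$, and let $$h\le\min\Big(\frac{\alpha}{J(A_{\max}+\alpha)^2},\frac{J}{\alpha}\Big)E_0^{-1},\qquad E_0=\frac1J\sum_{j=1}^J\|z_0^{(j)}-\bar z_0\|^2 .$$ Then there exists $B_1>0$ (independent of $t$) such that $$\mathbb E[\|\bar z_{t+1}-\bar z_t\|^2\mid\mathcal F_t]\le\frac{B_1}{(t+1)^2},$$ and there exists $B_2>0$ (independent of $t$) such that $$\max\big(\mathbb E[\|\bar z_t\|^2],\ \mathbb E[\|\bar z_t-z_\ast\|^2]\big)\le B_2(1+\log(t)),\quad t\ge1 .$$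
   Context: Observation model: on a probability space $(\Omega,\mathcal F,\mathbb P)$, an unknown $z_\ast\in\mathbb R^d$ is observed through $u_t=S_tz_\ast+w_t$, $t=1,2,\dots$, where $S_t\in\mathbb R^{p\times d}$ are (possibly random) matrices and $w_t\sim\mathcal N(0,\Gamma)$ are i.i.d., with $\Gamma\in\mathbb R^{p\times p}$ symmetric positive definite, and the noise is independent of the operators $(S_t)$. $\mathcal F_t=\sigma(S_s,u_s:1\le s\le t)$; $(w_s)_{s>t}$ is independent of $\mathcal F_t$, and the particle system below is adapted to $(\mathcal F_t)$. The constant $A_{\max}>0$ is a uniform bound: $\|S_t^\top S_t\|\le A_{\max}$ almost surely for all $t$. $\alpha>0$ is a fixed regularization parameter. DEKI: for an ensemble of $J$ particles $z_t^{(1)},\dots,z_t^{(J)}\in\mathbb R^d$ and step sizes $\eta_t>0$, for $t\ge0$, $$z_{t+1}^{(j)}=z_t^{(j)}-\eta_tC_t^{zz}\big(S_{t+1}^\top(S_{t+1}z_t^{(j)}-u_{t+1})+\alpha z_t^{(j)}\big),$$ with $\bar z_t=\frac1J\sum_{j=1}^Jz_t^{(j)}$ and $C_t^{zz}=\frac1J\sum_{j=1}^J(z_t^{(j)}-\bar z_t)(z_t^{(j)}-\bar z_t)^\top$. Here $\succ$ denotes the Loewner order.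
   Formalization: In the first bound B_1 is a positive integrable random variable not depending on t, and the bound holds almost surely; a deterministic B_1 is impossible in general, since the conditional expectation involves the square of the unbounded Gaussian-driven mean. *)

theory Defs
  imports "HOL-Probability.Probability"
begin

section \<open>Matrices\<close>

definition pos_def_matrix :: "real^'n^'n \<Rightarrow> bool" where
  "pos_def_matrix A \<longleftrightarrow> transpose A = A \<and> (\<forall>x. x \<noteq> 0 \<longrightarrow> 0 < x \<bullet> (A *v x))"

definition loewner_greater :: "real^'n^'n \<Rightarrow> real^'n^'n \<Rightarrow> bool"  (infix "\<succ>\<^sub>L" 50) where
  "A \<succ>\<^sub>L B \<longleftrightarrow> pos_def_matrix (A - B)"

text \<open>The class instance \<^const>\<open>norm\<close> on matrices is the Frobenius norm, so the spectral norm
  is taken from \<^const>\<open>onorm\<close>.\<close>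

definition op_norm :: "real^'n^'m \<Rightarrow> real" where
  "op_norm A = onorm ((*v) A)"

definition outer_product :: "real^'m \<Rightarrow> real^'n \<Rightarrow> real^'n^'m" where
  "outer_product x y = (\<chi> i k. x $ i * y $ k)"

section \<open>Observation model\<close>

definition gaussian_density :: "real^'p^'p \<Rightarrow> real^'p \<Rightarrow> real" where
  "gaussian_density \<Gamma> x =
     exp (- (x \<bullet> (matrix_inv \<Gamma> *v x)) / 2) / sqrt ((2 * pi) ^ CARD('p) * det \<Gamma>)"

definition obs :: "(nat \<Rightarrow> 'a \<Rightarrow> real^'d^'p) \<Rightarrow> (nat \<Rightarrow> 'a \<Rightarrow> real^'p) \<Rightarrow> real^'d
    \<Rightarrow> nat \<Rightarrow> 'a \<Rightarrow> real^'p" where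
  "obs S w zs t \<omega> = S t \<omega> *v zs + w t \<omega>"

definition gen_events :: "'a measure \<Rightarrow> (nat \<Rightarrow> 'a \<Rightarrow> 'b::topological_space) \<Rightarrow> nat set \<Rightarrow> 'a set set" where
  "gen_events M X I = (\<Union>i\<in>I. {X i -` A \<inter> space M | A. A \<in> sets borel})"

text \<open>The generated \<open>\<sigma>\<close>-algebras are carried by a \<^typ>\<open>'a measure\<close> because
  \<^const>\<open>real_cond_exp\<close> and measurability statements expect one; only their \<^const>\<open>space\<close> and
  \<^const>\<open>sets\<close> matter.\<close>

definition generated_by :: "'a measure \<Rightarrow> (nat \<Rightarrow> 'a \<Rightarrow> 'b::topological_space) \<Rightarrow> nat set \<Rightarrow> 'a measure" where
  "generated_by M X I = sigma (space M) (gen_events M X I)"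

text \<open>In particular the \<open>\<sigma>\<close>-algebra at time \<open>0\<close> is trivial.\<close>

definition obs_filtration :: "'a measure \<Rightarrow> (nat \<Rightarrow> 'a \<Rightarrow> real^'d^'p) \<Rightarrow> (nat \<Rightarrow> 'a \<Rightarrow> real^'p)
    \<Rightarrow> nat \<Rightarrow> 'a measure" where
  "obs_filtration M S u t = sigma (space M) (gen_events M S {1..t} \<union> gen_events M u {1..t})"

text \<open>Operators and noise are indexed from time \<open>1\<close> on; the values \<open>S 0\<close>, \<open>w 0\<close> are unconstrained
  and unused.\<close>

definition observation_model :: "'a measure \<Rightarrow> (nat \<Rightarrow> 'a \<Rightarrow> real^'d^'p) \<Rightarrow> (nat \<Rightarrow> 'a \<Rightarrow> real^'p)
    \<Rightarrow> real^'d \<Rightarrow> real^'p^'p \<Rightarrow> real \<Rightarrow> bool" where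
  "observation_model M S w zs \<Gamma> Amax \<longleftrightarrow>
     prob_space M \<and>
     (\<forall>t\<ge>1. S t \<in> borel_measurable M) \<and>
     pos_def_matrix \<Gamma> \<and>
     (\<forall>t\<ge>1. distributed M lborel (w t) (\<lambda>x. ennreal (gaussian_density \<Gamma> x))) \<and>
     prob_space.indep_vars M (\<lambda>_. borel) w {1..} \<and>
     prob_space.indep_set M (sets (generated_by M S {1..})) (sets (generated_by M w {1..})) \<and>
     (\<forall>t. prob_space.indep_set M (sets (obs_filtration M S (obs S w zs) t))
                                 (sets (generated_by M w {t<..}))) \<and>
     Amax > 0 \<and>
     (\<forall>t\<ge>1. AE \<omega> in M. op_norm (transpose (S t \<omega>) ** S t \<omega>) \<le> Amax)"

section \<open>Dynamic ensemble Kalman inversion\<close>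

text \<open>An ensemble at a fixed time is a family \<open>z j\<close> with \<open>j \<in> {1..J}\<close>.\<close>

definition ens_mean :: "nat \<Rightarrow> (nat \<Rightarrow> real^'d) \<Rightarrow> real^'d" where
  "ens_mean J z = (1 / real J) *\<^sub>R (\<Sum>j=1..J. z j)"

definition ens_cov :: "nat \<Rightarrow> (nat \<Rightarrow> real^'d) \<Rightarrow> real^'d^'d" where
  "ens_cov J z = (1 / real J) *\<^sub>R
     (\<Sum>j=1..J. outer_product (z j - ens_mean J z) (z j - ens_mean J z))"

definition ens_spread :: "nat \<Rightarrow> (nat \<Rightarrow> real^'d) \<Rightarrow> real" where
  "ens_spread J z = (1 / real J) * (\<Sum>j=1..J. (norm (z j - ens_mean J z))\<^sup>2)"

text \<open>Pathwise recursion for particles \<open>z t j\<close> with data \<open>S t\<close>, \<open>u t\<close> and step sizes \<open>\<eta> t\<close>.\<close>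

definition deki_recursion :: "nat \<Rightarrow> real \<Rightarrow> (nat \<Rightarrow> real) \<Rightarrow> (nat \<Rightarrow> real^'d^'p) \<Rightarrow> (nat \<Rightarrow> real^'p)
    \<Rightarrow> (nat \<Rightarrow> nat \<Rightarrow> real^'d) \<Rightarrow> bool" where
  "deki_recursion J \<alpha> \<eta> S u z \<longleftrightarrow>
     (\<forall>t. \<forall>j\<in>{1..J}.
        z (Suc t) j = z t j - \<eta> t *\<^sub>R (ens_cov J (z t) *v
          (transpose (S (Suc t)) *v (S (Suc t) *v z t j - u (Suc t)) + \<alpha> *\<^sub>R z t j)))"

definition deki :: "'a measure \<Rightarrow> nat \<Rightarrow> real \<Rightarrow> (nat \<Rightarrow> real) \<Rightarrow> (nat \<Rightarrow> 'a \<Rightarrow> real^'d^'p)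
    \<Rightarrow> (nat \<Rightarrow> 'a \<Rightarrow> real^'p) \<Rightarrow> (nat \<Rightarrow> nat \<Rightarrow> 'a \<Rightarrow> real^'d) \<Rightarrow> bool" where
  "deki M J \<alpha> \<eta> S u z \<longleftrightarrow>
     (\<forall>t. \<forall>j\<in>{1..J}. z t j \<in> borel_measurable (obs_filtration M S u t)) \<and>
     (\<forall>\<omega>\<in>space M. deki_recursion J \<alpha> \<eta> (\<lambda>t. S t \<omega>) (\<lambda>t. u t \<omega>) (\<lambda>t j. z t j \<omega>))"

abbreviation mean_path :: "nat \<Rightarrow> (nat \<Rightarrow> nat \<Rightarrow> 'a \<Rightarrow> real^'d) \<Rightarrow> nat \<Rightarrow> 'a \<Rightarrow> real^'d" where
  "mean_path J z t \<omega> \<equiv> ens_mean J (\<lambda>j. z t j \<omega>)"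

end

theory Submission
  imports Defs
begin

text \<open>
  Write \<open>A\<^sub>t\<^sub>+\<^sub>1 = S\<^sub>t\<^sub>+\<^sub>1\<^sup>T S\<^sub>t\<^sub>+\<^sub>1 + \<alpha> I\<close>. In one step all particles move by the same affine map,
  whose linear part is \<open>B\<^sub>t = I - h C\<^sub>t A\<^sub>t\<^sub>+\<^sub>1\<close>. Hence \<open>C\<^sub>t\<^sub>+\<^sub>1 = B\<^sub>t C\<^sub>t B\<^sub>t\<^sup>T\<close>, and with the
  propagator \<open>P\<^sub>t = B\<^sub>t\<^sub>-\<^sub>1 \<cdots> B\<^sub>0\<close> also \<open>C\<^sub>t = P\<^sub>t C\<^sub>0 P\<^sub>t\<^sup>T\<close>. Since \<open>\<F>\<^sub>0\<close> is trivial, the initial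
  ensemble is deterministic, so that all constants below are numbers.

  \<^emph>\<open>Collapse.\<close> The step size makes the quadratic term of the covariance update at most half of
  its linear term, which gives \<open>x \<bullet> C\<^sub>t\<^sub>+\<^sub>1 x \<le> x \<bullet> C\<^sub>t x - h \<alpha> |C\<^sub>t x|\<^sup>2\<close>. Taking traces, the spread
  \<open>E\<^sub>t = tr C\<^sub>t\<close> satisfies \<open>E\<^sub>t\<^sub>+\<^sub>1 \<le> E\<^sub>t - (h \<alpha> / d) E\<^sub>t\<^sup>2\<close>, so \<open>E\<^sub>t = O(1/t)\<close>. Because
  \<open>C\<^sub>0 \<ge> \<sigma> I\<close>, the identity \<open>C\<^sub>t = P\<^sub>t C\<^sub>0 P\<^sub>t\<^sup>T\<close> turns this into \<open>|P\<^sub>t| = O(t\<^sup>-\<^sup>1\<^sup>/\<^sup>2)\<close>.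

  \<^emph>\<open>The mean.\<close> A product of the non-symmetric matrices \<open>B\<^sub>t\<close> over a range \<open>s \<le> t\<close> has no evident
  contraction property. The way around this is the factorisation
  \<open>h C\<^sub>s S\<^sub>s\<^sub>+\<^sub>1\<^sup>T = P\<^sub>s\<^sub>+\<^sub>1 K\<^sub>s\<close> with the gain \<open>K\<^sub>s = h C\<^sub>0 P\<^sub>s\<^sup>T (B\<^sub>s\<^sup>T)\<^sup>-\<^sup>1 S\<^sub>s\<^sub>+\<^sub>1\<^sup>T\<close>, which is
  \<open>O(s\<^sup>-\<^sup>1\<^sup>/\<^sup>2)\<close>. It yields the variation-of-constants formula
  \<open>zbar\<^sub>t = P\<^sub>t (zbar\<^sub>0 + \<Sum>\<^sub>s K\<^sub>s u\<^sub>s\<^sub>+\<^sub>1)\<close>, the sum being over \<open>s < t\<close>, in which every past observation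
  is damped by the full factor \<open>t\<^sup>-\<^sup>1\<^sup>/\<^sup>2\<close>. The signal part \<open>S z\<^sub>*\<close> of \<open>u\<close> contributes \<open>O(\<surd>t)\<close> to the
  sum, hence a bounded amount to the mean.

  \<^emph>\<open>The noise.\<close> Put \<open>N\<^sub>t = \<Sum>\<^sub>s K\<^sub>s w\<^sub>s\<^sub>+\<^sub>1\<close>. Its increments are orthogonal to its past, since \<open>w\<^sub>t\<^sub>+\<^sub>1\<close> is
  centred and independent of all operators and of the earlier noise, and they have variance
  \<open>O(1/t)\<close>. For such a walk one integrable variable dominates \<open>|N\<^sub>t|\<^sup>2 / (t + 1)\<close> for all \<open>t\<close> at once
  (\<open>normalized_walk_dominated\<close>). So one integrable \<open>Y\<close> dominates \<open>|zbar\<^sub>t|\<^sup>2\<close> for all \<open>t\<close>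
  (\<open>mean_dominated\<close>).

  Both claims follow. The second moments of \<open>zbar\<^sub>t\<close> and \<open>zbar\<^sub>t - z\<^sub>*\<close> are bounded in terms of the
  expectation of \<open>Y\<close>. The increment of the mean is at most \<open>|C\<^sub>t| = O(1/t)\<close> times an affine expression
  in \<open>|zbar\<^sub>t|\<close> and \<open>|w\<^sub>t\<^sub>+\<^sub>1|\<close>; conditioning replaces \<open>|w\<^sub>t\<^sub>+\<^sub>1|\<^sup>2\<close> by its expectation, and \<open>Y\<close> removes
  the dependence on \<open>t\<close>.
\<close>

(* Adjoints are moved with inner_matrix_vector_adjoint below; the default rule would rewrite its
   right-hand side into a vector-matrix product. *)
declare transpose_matrix_vector [simp del]

section \<open>Matrices as bilinear forms\<close>

lemma inner_matrix_vector_adjoint: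
  fixes A :: "real^'n^'m"
  shows "x \<bullet> (A *v y) = (transpose A *v x) \<bullet> y"
  by (simp add: dot_lmul_matrix transpose_matrix_vector)

lemma matrix_eq_if_inner_eq:
  fixes A B :: "real^'n^'m"
  assumes "\<And>x y. x \<bullet> (A *v y) = x \<bullet> (B *v y)"
  shows "A = B"
proof -
  have "A *v y = B *v y" for y
    using vector_eq_rdot[of "A *v y" "B *v y"] assms by (simp add: inner_commute)
  then show ?thesis by (simp add: matrix_eq)
qed

lemma scaleR_matrix_vector: "(c *\<^sub>R A) *v x = c *\<^sub>R ((A::real^'n^'m) *v x)"
  by (simp add: scaleR_matrix_vector_assoc)

text \<open>A matrix and its transpose have the same operator norm; half of this is obtained by testing
  \<open>A\<close> on \<open>A\<^sup>T y\<close>.\<close>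

lemma norm_transpose_mult_le:
  fixes A :: "real^'n^'m"
  assumes "\<And>x. norm (A *v x) \<le> b * norm x"
  shows "norm (transpose A *v y) \<le> b * norm y"
proof (cases "transpose A *v y = 0")
  case True
  have "0 \<le> b * norm (axis undefined 1 :: real^'n)"
    using assms order_trans norm_ge_zero by blast
  then show ?thesis by (simp add: True)
next
  case False
  let ?v = "transpose A *v y"
  have "norm ?v * norm ?v = y \<bullet> (A *v ?v)"
    by (simp add: inner_matrix_vector_adjoint power2_norm_eq_inner[symmetric] power2_eq_square)
  also have "\<dots> \<le> norm y * norm (A *v ?v)"
    by (rule norm_cauchy_schwarz)
  also have "\<dots> \<le> norm y * (b * norm ?v)"
    by (rule mult_left_mono[OF assms]) simp
  finally show ?thesis using False by (simp add: mult.commute mult.left_commute)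
qed

lemma matrix_inv_right:
  fixes A :: "real^'n^'m"
  assumes "invertible A"
  shows "A ** matrix_inv A = mat 1"
  using someI_ex[OF assms[unfolded invertible_def]] by (simp add: matrix_inv_def)

lemma inner_scaleR_mat: "x \<bullet> ((c *\<^sub>R mat 1) *v y) = c * (x \<bullet> (y::real^'n))"
  by (simp add: scaleR_matrix_vector)

lemma trace_eq_sum_inner:
  fixes A :: "real^'n^'n"
  shows "trace A = (\<Sum>i\<in>UNIV. axis i 1 \<bullet> (A *v axis i 1))"
  by (simp add: trace_def inner_axis' matrix_vector_mul_component inner_axis)

text \<open>Two applications of Cauchy-Schwarz, one per diagonal entry and one over the diagonal. The sum on
  the right is, up to the factor \<open>h \<alpha>\<close>, the decrease of the spread in one step, so this is what makes the decrease
  quadratic in the spread.\<close>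

lemma trace_square_le:
  fixes C :: "real^'n^'n"
  shows "(trace C)\<^sup>2 \<le> real CARD('n) * (\<Sum>i\<in>UNIV. (norm (C *v axis i 1))\<^sup>2)"
proof -
  have "(trace C)\<^sup>2 \<le> real CARD('n) * (\<Sum>i\<in>UNIV. (axis i 1 \<bullet> (C *v axis i 1))\<^sup>2)"
    unfolding trace_eq_sum_inner
    using sum_squared_le_sum_of_squares[of "\<lambda>i. axis i 1 \<bullet> (C *v axis i 1)" UNIV]
    by (simp add: mult.commute)
  also have "\<dots> \<le> real CARD('n) * (\<Sum>i\<in>UNIV. (norm (C *v axis i 1))\<^sup>2)"
  proof (intro mult_left_mono sum_mono)
    fix i :: 'n
    have "\<bar>axis i 1 \<bullet> (C *v axis i 1)\<bar> \<le> norm (C *v axis i 1)"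
      using Cauchy_Schwarz_ineq2[of "axis i 1" "C *v axis i 1"] by (simp add: norm_axis_1)
    then show "(axis i 1 \<bullet> (C *v axis i 1))\<^sup>2 \<le> (norm (C *v axis i 1))\<^sup>2"
      by (metis abs_le_square_iff abs_norm_cancel)
  qed auto
  finally show ?thesis .
qed

section \<open>Operator bounds on the data\<close>

lemma norm_mult_le_op_norm: "norm ((A::real^'n^'m) *v x) \<le> op_norm A * norm x"
  unfolding op_norm_def by (intro onorm) (simp add: matrix_vector_mul_bounded_linear)

lemma norm_forward_le:
  fixes S :: "real^'d^'p"
  assumes "op_norm (transpose S ** S) \<le> a"
  shows "norm (S *v x) \<le> sqrt a * norm x"
proof -
  have "(norm (S *v x))\<^sup>2 = x \<bullet> ((transpose S ** S) *v x)"
    by (simp add: power2_norm_eq_inner matrix_vector_mul_assoc[symmetric] inner_matrix_vector_adjoint[of x])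
  also have "\<dots> \<le> norm x * norm ((transpose S ** S) *v x)"
    by (rule norm_cauchy_schwarz)
  also have "\<dots> \<le> norm x * (a * norm x)"
    by (intro mult_left_mono order_trans[OF norm_mult_le_op_norm] mult_right_mono assms) auto
  finally have "sqrt ((norm (S *v x))\<^sup>2) \<le> sqrt (a * (norm x)\<^sup>2)"
    by (intro real_sqrt_le_mono) (simp add: power2_eq_square mult_ac)
  then show ?thesis by (simp add: real_sqrt_mult)
qed

definition reg_hessian :: "real \<Rightarrow> real^'d^'p \<Rightarrow> real^'d^'d" where
  "reg_hessian \<alpha> S = transpose S ** S + \<alpha> *\<^sub>R mat 1"

lemma reg_hessian_mult:
  "reg_hessian \<alpha> S *v x = transpose S *v (S *v x) + \<alpha> *\<^sub>R x"
  by (simp add: reg_hessian_def matrix_vector_mult_add_rdistrib scaleR_matrix_vector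
      matrix_vector_mul_assoc)

lemma transpose_add: "transpose (A + B) = transpose A + transpose (B::real^'n^'m)"
  by (simp add: transpose_def vec_eq_iff)

lemma transpose_diff: "transpose (A - B) = transpose A - transpose (B::real^'n^'m)"
  by (simp add: transpose_def vec_eq_iff)

lemma transpose_scaleR: "transpose (c *\<^sub>R A) = c *\<^sub>R transpose (A::real^'n^'m)"
  by (simp add: transpose_def vec_eq_iff)

lemma transpose_reg_hessian: "transpose (reg_hessian \<alpha> S) = reg_hessian \<alpha> S"
  by (simp add: reg_hessian_def transpose_add transpose_scaleR matrix_transpose_mul)

lemma reg_hessian_coercive: "\<alpha> * (x \<bullet> x) \<le> x \<bullet> (reg_hessian \<alpha> S *v x)"
  by (simp add: reg_hessian_mult inner_add_right inner_matrix_vector_adjoint[of x "transpose S"])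

lemma norm_reg_hessian_le:
  assumes "op_norm (transpose S ** S) \<le> a" "0 \<le> \<alpha>"
  shows "norm (reg_hessian \<alpha> S *v x) \<le> (a + \<alpha>) * norm x"
proof -
  have "norm (reg_hessian \<alpha> S *v x) \<le> norm ((transpose S ** S) *v x) + \<alpha> * norm x"
    unfolding reg_hessian_mult matrix_vector_mul_assoc
    using norm_triangle_ineq \<open>0 \<le> \<alpha>\<close> by (metis abs_of_nonneg norm_scaleR)
  also have "\<dots> \<le> a * norm x + \<alpha> * norm x"
    by (intro add_right_mono order_trans[OF norm_mult_le_op_norm] mult_right_mono assms) auto
  finally show ?thesis by (simp add: algebra_simps)
qed

section \<open>Ensemble statistics\<close>

lemma ens_mean_cong: "(\<And>j. j \<in> {1..J} \<Longrightarrow> z j = z' j) \<Longrightarrow> ens_mean J z = ens_mean J z'"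
  by (simp add: ens_mean_def)

lemma ens_cov_cong: "(\<And>j. j \<in> {1..J} \<Longrightarrow> z j = z' j) \<Longrightarrow> ens_cov J z = ens_cov J z'"
  using ens_mean_cong[of J z z'] by (simp add: ens_cov_def)

lemma ens_spread_cong: "(\<And>j. j \<in> {1..J} \<Longrightarrow> z j = z' j) \<Longrightarrow> ens_spread J z = ens_spread J z'"
  using ens_mean_cong[of J z z'] by (simp add: ens_spread_def)

lemma outer_product_mult: "outer_product a b *v y = (b \<bullet> y) *\<^sub>R a"
  by (simp add: vec_eq_iff outer_product_def matrix_vector_mult_def inner_vec_def sum_distrib_left
      mult_ac)

lemma sum_matrix_vector_mult:
  fixes f :: "'i \<Rightarrow> real^'n^'m"
  shows "(\<Sum>i\<in>I. f i) *v x = (\<Sum>i\<in>I. f i *v x)"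
  by (induction I rule: infinite_finite_induct) (auto simp: matrix_vector_mult_add_rdistrib)

lemma inner_ens_cov:
  "x \<bullet> (ens_cov J z *v y) =
     (1 / real J) * (\<Sum>j=1..J. (x \<bullet> (z j - ens_mean J z)) * (y \<bullet> (z j - ens_mean J z)))"
  by (simp add: ens_cov_def scaleR_matrix_vector sum_matrix_vector_mult outer_product_mult
      inner_sum_right inner_commute mult_ac)

lemma transpose_ens_cov: "transpose (ens_cov J z) = ens_cov J z"
  by (simp add: vec_eq_iff transpose_def ens_cov_def outer_product_def sum_component mult_ac)

lemma trace_ens_cov: "trace (ens_cov J z) = ens_spread J z"
proof -
  have "trace (ens_cov J z) = 
     (1 / real J) * (\<Sum>i\<in>UNIV. \<Sum>j=1..J. ((z j - ens_mean J z) $ i)\<^sup>2)"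
    by (simp add: trace_eq_sum_inner inner_ens_cov sum_distrib_left inner_axis' power2_eq_square)
  also have "\<dots> = ens_spread J z"
    unfolding ens_spread_def power2_norm_eq_inner inner_vec_def
    by (subst sum.swap) (simp add: power2_eq_square)
  finally show ?thesis .
qed

lemma ens_spread_nonneg: "0 \<le> ens_spread J z"
  by (simp add: ens_spread_def sum_nonneg)

lemma inner_ens_cov_le: "x \<bullet> (ens_cov J z *v y) \<le> ens_spread J z * norm x * norm y"
proof -
  have "(x \<bullet> v) * (y \<bullet> v) \<le> (norm v)\<^sup>2 * (norm x * norm y)" for v
  proof -
    have "(x \<bullet> v) * (y \<bullet> v) \<le> \<bar>x \<bullet> v\<bar> * \<bar>y \<bullet> v\<bar>" by (metis abs_ge_self abs_mult)
    also have "\<dots> \<le> (norm x * norm v) * (norm y * norm v)"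
      by (intro mult_mono Cauchy_Schwarz_ineq2) auto
    finally show ?thesis by (simp add: power2_eq_square mult_ac)
  qed
  then have "(\<Sum>j=1..J. (x \<bullet> (z j - ens_mean J z)) * (y \<bullet> (z j - ens_mean J z)))
      \<le> (\<Sum>j=1..J. (norm (z j - ens_mean J z))\<^sup>2) * (norm x * norm y)"
    unfolding sum_distrib_right by (intro sum_mono)
  then have "x \<bullet> (ens_cov J z *v y)
      \<le> (1 / real J) * ((\<Sum>j=1..J. (norm (z j - ens_mean J z))\<^sup>2) * (norm x * norm y))"
    unfolding inner_ens_cov by (intro mult_left_mono) auto
  then show ?thesis by (simp add: ens_spread_def mult_ac)
qed

lemma norm_ens_cov_le: "norm (ens_cov J z *v y) \<le> ens_spread J z * norm y"
proof (cases "ens_cov J z *v y = 0")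
  case True
  then show ?thesis by (simp add: ens_spread_nonneg)
next
  case False
  then show ?thesis
    using inner_ens_cov_le[of "ens_cov J z *v y" J z y]
    by (simp add: power2_norm_eq_inner[symmetric] power2_eq_square mult_ac)
qed

lemma matrix_vector_mult_sum_right:
  fixes f :: "'i \<Rightarrow> real^'n"
  shows "(A::real^'n^'m) *v (\<Sum>i\<in>I. f i) = (\<Sum>i\<in>I. A *v f i)"
  by (induction I rule: infinite_finite_induct) (auto simp: matrix_vector_right_distrib)

lemma ens_mean_affine:
  assumes "J \<ge> 1"
  shows "ens_mean J (\<lambda>j. B *v z j + c) = B *v ens_mean J z + c"
  using assms
  by (simp add: ens_mean_def sum.distrib matrix_vector_mult_scaleR scaleR_add_right
      matrix_vector_right_distrib matrix_vector_mult_sum_right sum_constant_scaleR del: sum_constant)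

text \<open>The translation cancels in the deviations from the mean. A DEKI step is such an affine map.\<close>

lemma ens_cov_affine:
  fixes B :: "real^'d^'d"
  assumes "J \<ge> 1"
  shows "ens_cov J (\<lambda>j. B *v z j + c) = B ** ens_cov J z ** transpose B"
proof (rule matrix_eq_if_inner_eq)
  fix x y :: "real^'d"
  have "x \<bullet> (ens_cov J (\<lambda>j. B *v z j + c) *v y) =
     (1 / real J) * (\<Sum>j=1..J. (x \<bullet> (B *v (z j - ens_mean J z))) * (y \<bullet> (B *v (z j - ens_mean J z))))"
    unfolding inner_ens_cov ens_mean_affine[OF assms]
    by (simp add: matrix_vector_mult_diff_distrib)
  also have "\<dots> = (transpose B *v x) \<bullet> (ens_cov J z *v (transpose B *v y))"
    by (subst inner_ens_cov) (simp add: inner_commute inner_matrix_vector_adjoint[of x B] inner_matrix_vector_adjoint[of y B])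
  finally show "x \<bullet> (ens_cov J (\<lambda>j. B *v z j + c) *v y) = x \<bullet> ((B ** ens_cov J z ** transpose B) *v y)"
    by (simp add: matrix_vector_mul_assoc[symmetric] inner_matrix_vector_adjoint[of x B])
qed

section \<open>Pathwise analysis\<close>

text \<open>The linear part \<open>B\<close> of one DEKI step; the observed value \<open>u\<close> only enters its translation part.\<close>

definition step_matrix :: "real \<Rightarrow> real \<Rightarrow> real^'d^'d \<Rightarrow> real^'d^'p \<Rightarrow> real^'d^'d" where
  "step_matrix h \<alpha> C S = mat 1 - h *\<^sub>R (C ** reg_hessian \<alpha> S)"

primrec propagator ::
  "nat \<Rightarrow> real \<Rightarrow> real \<Rightarrow> (nat \<Rightarrow> real^'d^'p) \<Rightarrow> (nat \<Rightarrow> nat \<Rightarrow> real^'d) \<Rightarrow> nat \<Rightarrow> real^'d^'d" where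
  "propagator J \<alpha> h S z 0 = mat 1"
| "propagator J \<alpha> h S z (Suc t) =
     step_matrix h \<alpha> (ens_cov J (z t)) (S (Suc t)) ** propagator J \<alpha> h S z t"

text \<open>The matrix \<open>K\<^sub>t\<close> for which \<open>P\<^sub>t\<^sub>+\<^sub>1 K\<^sub>t = h C\<^sub>t S\<^sub>t\<^sub>+\<^sub>1\<^sup>T\<close>: the factor \<open>P\<^sub>t\<^sub>+\<^sub>1\<close> is pulled out of the
  weight of the observation at time \<open>t + 1\<close>, see \<open>propagator_gain\<close>.\<close>

definition gain ::
  "nat \<Rightarrow> real \<Rightarrow> real \<Rightarrow> (nat \<Rightarrow> real^'d^'p) \<Rightarrow> (nat \<Rightarrow> nat \<Rightarrow> real^'d) \<Rightarrow> nat \<Rightarrow> real^'p^'d" where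
  "gain J \<alpha> h S z t = h *\<^sub>R (ens_cov J (z 0) ** transpose (propagator J \<alpha> h S z t) **
     matrix_inv (transpose (step_matrix h \<alpha> (ens_cov J (z t)) (S (Suc t)))) ** transpose (S (Suc t)))"

text \<open>The sum \<open>\<Sum>\<^sub>s K\<^sub>s v\<^sub>s\<^sub>+\<^sub>1\<close> over \<open>s < t\<close>. It is kept linear in the forcing \<open>v\<close> so that it can be split
  into a signal part and a noise part.\<close>

primrec response ::
  "nat \<Rightarrow> real \<Rightarrow> real \<Rightarrow> (nat \<Rightarrow> real^'d^'p) \<Rightarrow> (nat \<Rightarrow> nat \<Rightarrow> real^'d) \<Rightarrow> (nat \<Rightarrow> real^'p) \<Rightarrow> nat
    \<Rightarrow> real^'d" where
  "response J \<alpha> h S z v 0 = 0"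
| "response J \<alpha> h S z v (Suc t) = response J \<alpha> h S z v t + gain J \<alpha> h S z t *v v (Suc t)"

lemma response_add:
  "response J \<alpha> h S z (\<lambda>t. v t + v' t) t = response J \<alpha> h S z v t + response J \<alpha> h S z v' t"
  by (induction t) (simp_all add: matrix_vector_right_distrib)

lemma step_matrix_mult:
  "step_matrix h \<alpha> C S *v x = x - h *\<^sub>R (C *v (reg_hessian \<alpha> S *v x))"
  by (simp add: step_matrix_def matrix_vector_mult_diff_rdistrib scaleR_matrix_vector
      matrix_vector_mul_assoc)

lemma transpose_step_matrix_mult:
  assumes "transpose C = C"
  shows "transpose (step_matrix h \<alpha> C S) *v x = x - h *\<^sub>R (reg_hessian \<alpha> S *v (C *v x))"
  by (simp add: step_matrix_def transpose_diff transpose_scaleR matrix_transpose_mul assms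
      transpose_reg_hessian matrix_vector_mult_diff_rdistrib scaleR_matrix_vector
      matrix_vector_mul_assoc)

text \<open>The discrete version of \<open>x' = - c x\<^sup>2\<close>. From \<open>(1 - y) (1 + y) \<le> 1\<close> one gets
  \<open>x\<^sub>t\<^sub>+\<^sub>1 \<le> x\<^sub>t / (1 + c x\<^sub>t)\<close>, whose right-hand side, unlike \<open>x - c x\<^sup>2\<close>, is monotone in \<open>x\<^sub>t\<close>, so that the
  induction hypothesis can be inserted.\<close>

lemma rational_decay:
  fixes x :: "nat \<Rightarrow> real"
  assumes nonneg: "\<And>t. 0 \<le> x t" and c: "0 < c" and x0: "x 0 \<le> \<kappa>" and \<kappa>: "1 \<le> c * \<kappa>"
    and dec: "\<And>t. x (Suc t) \<le> x t - c * (x t)\<^sup>2"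
  shows "x t \<le> \<kappa> / (real t + 1)"
proof (induction t)
  case 0
  then show ?case using x0 by simp
next
  case (Suc t)
  define q where "q = \<kappa> / (real t + 1)"
  have \<kappa>0: "0 < \<kappa>" using \<kappa> c by (metis less_le_trans zero_less_mult_pos zero_less_one)
  have pos: "0 < 1 + c * x t" using nonneg[of t] c by (simp add: add_pos_nonneg)
  have "(x t - c * (x t)\<^sup>2) * (1 + c * x t) \<le> x t"
  proof -
    have "(x t - c * (x t)\<^sup>2) * (1 + c * x t) = x t - c * c * (x t)^3"
      by (simp add: algebra_simps power2_eq_square power3_eq_cube)
    then show ?thesis using nonneg[of t] c by simp
  qed
  then have "x (Suc t) \<le> x t / (1 + c * x t)"
    using dec[of t] pos by (metis order_trans pos_le_divide_eq)
  also have "\<dots> \<le> q / (1 + c * q)"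
  proof -
    have "0 < 1 + c * q" using c \<kappa>0 by (simp add: q_def add_pos_nonneg)
    moreover have "x t * (1 + c * q) \<le> q * (1 + c * x t)"
      using Suc[folded q_def] by (simp add: algebra_simps)
    ultimately show ?thesis using pos by (simp add: divide_le_eq pos_le_divide_eq)
  qed
  also have "\<dots> = \<kappa> / (real t + 1 + c * \<kappa>)"
  proof -
    have "real t + 1 + c * \<kappa> = (real t + 1) * (1 + c * q)"
      by (simp add: q_def distrib_left)
    then show ?thesis by (simp add: q_def)
  qed
  also have "\<dots> \<le> \<kappa> / (real (Suc t) + 1)"
    using \<kappa> \<kappa>0 by (intro divide_left_mono) (auto simp: add_pos_pos)
  finally show ?case .
qed

text \<open>The induction step for \<open>\<Sum> 1 / \<surd>(s + 1) \<le> 2 \<surd>t\<close>.\<close>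

lemma sqrt_increment: "2 * sqrt (real t) + 1 / sqrt (real t + 1) \<le> 2 * sqrt (real t + 1)"
proof -
  have "(sqrt (real t) - sqrt (real t + 1))\<^sup>2 \<ge> 0" by simp
  then have "2 * sqrt (real t) * sqrt (real t + 1) + 1 \<le> 2 * (real t + 1)"
    by (simp add: power2_diff)
  then have "2 * sqrt (real t) * sqrt (real t + 1) + 1 \<le> (2 * sqrt (real t + 1)) * sqrt (real t + 1)"
    by (simp add: mult.assoc)
  then show ?thesis by (simp add: field_simps)
qed

text \<open>One realisation of the ensemble. The constant \<open>\<kappa>\<close> is any number large enough for the bound
  \<open>E\<^sub>t \<le> \<kappa> / (t + 1)\<close> to hold at time \<open>0\<close> and to be reproduced by \<open>rational_decay\<close>.\<close>

locale deki_path =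
  fixes J :: nat and \<alpha> h \<sigma> a \<kappa> :: real
    and S :: "nat \<Rightarrow> real^'d^'p" and u :: "nat \<Rightarrow> real^'p" and z :: "nat \<Rightarrow> nat \<Rightarrow> real^'d"
  assumes J: "1 \<le> J" and \<alpha>: "0 < \<alpha>" and h: "0 < h" and \<sigma>: "0 < \<sigma>" and a: "0 < a"
    and recursion: "deki_recursion J \<alpha> (\<lambda>_. h) S u z"
    and forward_bound: "\<And>t. t \<ge> 1 \<Longrightarrow> op_norm (transpose (S t) ** S t) \<le> a"
    and init: "ens_cov J (z 0) \<succ>\<^sub>L \<sigma> *\<^sub>R mat 1"
    and step_size: "h * ens_spread J (z 0) * (a + \<alpha>)\<^sup>2 \<le> \<alpha>"
    and \<kappa>_init: "ens_spread J (z 0) \<le> \<kappa>"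
    and \<kappa>_dim: "real CARD('d) \<le> h * \<alpha> * \<kappa>"
begin

abbreviation "C t \<equiv> ens_cov J (z t)"
abbreviation "E t \<equiv> ens_spread J (z t)"
abbreviation "A t \<equiv> reg_hessian \<alpha> (S (Suc t))"
abbreviation "B t \<equiv> step_matrix h \<alpha> (C t) (S (Suc t))"
abbreviation "P t \<equiv> propagator J \<alpha> h S z t"
abbreviation "zbar t \<equiv> ens_mean J (z t)"

lemma particle_step:
  assumes "j \<in> {1..J}"
  shows "z (Suc t) j = B t *v z t j + h *\<^sub>R (C t *v (transpose (S (Suc t)) *v u (Suc t)))"
proof -
  have "z (Suc t) j = z t j - h *\<^sub>R (C t *v
          (transpose (S (Suc t)) *v (S (Suc t) *v z t j - u (Suc t)) + \<alpha> *\<^sub>R z t j))"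
    using recursion assms unfolding deki_recursion_def by blast
  also have "transpose (S (Suc t)) *v (S (Suc t) *v z t j - u (Suc t)) + \<alpha> *\<^sub>R z t j
      = A t *v z t j - transpose (S (Suc t)) *v u (Suc t)"
    by (simp add: reg_hessian_mult matrix_vector_mult_diff_distrib)
  finally show ?thesis
    by (simp add: step_matrix_mult matrix_vector_mult_diff_distrib scaleR_diff_right)
qed

lemma mean_step:
  "zbar (Suc t) = B t *v zbar t + h *\<^sub>R (C t *v (transpose (S (Suc t)) *v u (Suc t)))"
  using ens_mean_cong[OF particle_step] by (simp add: ens_mean_affine[OF J])

lemma cov_step: "C (Suc t) = B t ** C t ** transpose (B t)"
  using ens_cov_cong[OF particle_step] by (simp add: ens_cov_affine[OF J])

lemma cov_propagator: "C t = P t ** C 0 ** transpose (P t)"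
proof (induction t)
  case (Suc t)
  then show ?case by (simp add: cov_step matrix_transpose_mul matrix_mul_assoc)
qed simp

lemma norm_A_le: "norm (A t *v x) \<le> (a + \<alpha>) * norm x"
  using norm_reg_hessian_le[OF forward_bound] \<alpha> by simp

lemma init_coercive: "\<sigma> * (x \<bullet> x) \<le> x \<bullet> (C 0 *v x)"
proof (cases "x = 0")
  case False
  then have "0 < x \<bullet> ((C 0 - \<sigma> *\<^sub>R mat 1) *v x)"
    using init by (auto simp: loewner_greater_def pos_def_matrix_def)
  then show ?thesis by (simp add: matrix_vector_mult_diff_rdistrib inner_diff_right inner_scaleR_mat)
qed simp

lemma \<kappa>_pos: "0 < \<kappa>"
  using \<kappa>_dim h \<alpha> 
  by (metis less_le_trans mult_pos_pos of_nat_0_less_iff zero_less_card_finite zero_less_mult_pos)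

text \<open>With \<open>y = C x\<close> the updated form is \<open>x \<bullet> y - 2 h (y \<bullet> A y) + h\<^sup>2 (A y \<bullet> C A y)\<close>. Here
  \<open>y \<bullet> A y \<ge> \<alpha> |y|\<^sup>2\<close> and \<open>A y \<bullet> C A y \<le> E (a + \<alpha>)\<^sup>2 |y|\<^sup>2\<close>, so the smallness condition makes the last
  term at most half of the middle one. The trace then gives the inequality for the spread.\<close>

lemma spread_step_if:
  assumes small: "h * E t * (a + \<alpha>)\<^sup>2 \<le> \<alpha>"
  shows "E (Suc t) \<le> E t - (h * \<alpha> / real CARD('d)) * (E t)\<^sup>2"
proof -
  have form: "x \<bullet> (C (Suc t) *v x) \<le> x \<bullet> (C t *v x) - h * \<alpha> * (norm (C t *v x))\<^sup>2" for x
  proof -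
    define y where "y = C t *v x"
    define v where "v = A t *v y"
    have "x \<bullet> (C (Suc t) *v x) = (x - h *\<^sub>R v) \<bullet> (C t *v (x - h *\<^sub>R v))"
      by (simp add: cov_step matrix_vector_mul_assoc[symmetric] inner_matrix_vector_adjoint[of x "B t"]
          transpose_step_matrix_mult transpose_ens_cov v_def y_def)
    also have "\<dots> = x \<bullet> y - 2 * h * (y \<bullet> v) + h\<^sup>2 * (v \<bullet> (C t *v v))"
      using inner_matrix_vector_adjoint[of x "C t" v]
      by (simp add: matrix_vector_mult_diff_distrib matrix_vector_mult_scaleR y_def[symmetric]
          inner_diff_left inner_diff_right transpose_ens_cov power2_eq_square algebra_simps
          inner_commute)
    also have "\<dots> \<le> x \<bullet> y - 2 * h * (\<alpha> * (norm y)\<^sup>2) + h * (\<alpha> * (norm y)\<^sup>2)"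
    proof -
      have 1: "2 * h * (\<alpha> * (norm y)\<^sup>2) \<le> 2 * h * (y \<bullet> v)"
        using reg_hessian_coercive[of \<alpha> y "S (Suc t)"] h
        by (intro mult_left_mono) (auto simp: v_def power2_norm_eq_inner)
      have "v \<bullet> (C t *v v) \<le> E t * (norm v)\<^sup>2"
        using inner_ens_cov_le[of v J "z t" v] by (simp add: power2_eq_square mult_ac)
      also have "\<dots> \<le> E t * ((a + \<alpha>) * norm y)\<^sup>2"
        using norm_A_le[of t y] by (intro mult_left_mono power_mono) (auto simp: v_def ens_spread_nonneg)
      finally have "h\<^sup>2 * (v \<bullet> (C t *v v)) \<le> h * ((h * E t * (a + \<alpha>)\<^sup>2) * (norm y)\<^sup>2)"
        using h by (simp add: power2_eq_square mult_ac)
      also have "\<dots> \<le> h * (\<alpha> * (norm y)\<^sup>2)"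
        using h by (intro mult_left_mono mult_right_mono small) auto
      finally show ?thesis using 1 by linarith
    qed
    finally show ?thesis by (simp add: y_def mult_ac)
  qed
  have "E (Suc t) \<le> E t - h * \<alpha> * (\<Sum>i\<in>UNIV. (norm (C t *v axis i 1))\<^sup>2)"
    unfolding trace_ens_cov[symmetric] trace_eq_sum_inner sum_distrib_left sum_subtractf[symmetric]
    by (intro sum_mono form)
  also have "\<dots> \<le> E t - h * \<alpha> * ((E t)\<^sup>2 / real CARD('d))"
    using trace_square_le[of "C t"] h \<alpha>
    by (intro diff_left_mono mult_left_mono) (auto simp: trace_ens_cov pos_divide_le_eq mult.commute)
  finally show ?thesis by (simp add: field_simps)
qed

lemma spread_le_init: "E t \<le> E 0"
proof (induction t)
  case (Suc t)
  have "h * E t * (a + \<alpha>)\<^sup>2 \<le> h * E 0 * (a + \<alpha>)\<^sup>2"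
    using Suc h by (intro mult_right_mono mult_left_mono) auto
  then have "E (Suc t) \<le> E t - (h * \<alpha> / real CARD('d)) * (E t)\<^sup>2"
    using step_size by (intro spread_step_if) simp
  also have "\<dots> \<le> E t" using h \<alpha> by simp
  finally show ?case using Suc by simp
qed simp

lemma small_step: "h * E t * (a + \<alpha>)\<^sup>2 \<le> \<alpha>"
proof -
  have "h * E t * (a + \<alpha>)\<^sup>2 \<le> h * E 0 * (a + \<alpha>)\<^sup>2"
    using spread_le_init h by (intro mult_right_mono mult_left_mono) auto
  then show ?thesis using step_size by simp
qed

lemma spread_decay: "E t \<le> \<kappa> / (real t + 1)"
proof (rule rational_decay[where c = "h * \<alpha> / real CARD('d)"])
  show "1 \<le> h * \<alpha> / real CARD('d) * \<kappa>"
    using \<kappa>_dim by (simp add: field_simps)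
qed (use h \<alpha> \<kappa>_init spread_step_if[OF small_step] in \<open>auto simp: ens_spread_nonneg\<close>)

text \<open>Compare the two readings of \<open>x \<bullet> C\<^sub>t x\<close>: it is at most \<open>E\<^sub>t |x|\<^sup>2\<close>, and it equals
  \<open>P\<^sub>t\<^sup>T x \<bullet> C\<^sub>0 P\<^sub>t\<^sup>T x\<close>, which is at least \<open>\<sigma> |P\<^sub>t\<^sup>T x|\<^sup>2\<close>.\<close>

lemma norm_transpose_propagator_le:
  "norm (transpose (P t) *v x) \<le> sqrt (\<kappa> / \<sigma>) / sqrt (real t + 1) * norm x"
proof -
  let ?y = "transpose (P t) *v x"
  have "\<sigma> * (norm ?y)\<^sup>2 \<le> ?y \<bullet> (C 0 *v ?y)"
    using init_coercive[of ?y] by (simp add: power2_norm_eq_inner)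
  also have "\<dots> = x \<bullet> (C t *v x)"
    by (subst (2) cov_propagator)
      (simp add: matrix_vector_mul_assoc[symmetric] inner_matrix_vector_adjoint[of x "P t"])
  also have "\<dots> \<le> E t * (norm x)\<^sup>2"
    using inner_ens_cov_le[of x J "z t" x] by (simp add: power2_eq_square mult_ac)
  also have "\<dots> \<le> \<kappa> / (real t + 1) * (norm x)\<^sup>2"
    by (intro mult_right_mono spread_decay) auto
  finally have "(norm ?y)\<^sup>2 \<le> \<kappa> / \<sigma> / (real t + 1) * (norm x)\<^sup>2"
    using \<sigma> by (simp add: pos_le_divide_eq mult_ac)
  then have "sqrt ((norm ?y)\<^sup>2) \<le> sqrt (\<kappa> / \<sigma> / (real t + 1) * (norm x)\<^sup>2)"
    by (rule real_sqrt_le_mono)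
  then show ?thesis by (simp add: real_sqrt_mult real_sqrt_divide)
qed

lemma norm_propagator_le:
  "norm (P t *v x) \<le> sqrt (\<kappa> / \<sigma>) / sqrt (real t + 1) * norm x"
  using norm_transpose_mult_le[OF norm_transpose_propagator_le] by simp

text \<open>The step size gives \<open>h |A C\<^sub>t| \<le> h (a + \<alpha>) E\<^sub>t \<le> \<alpha> / (a + \<alpha>) < 1\<close>, so \<open>B\<^sub>t\<^sup>T = I - h A C\<^sub>t\<close> is
  boundedly invertible uniformly in \<open>t\<close>.\<close>

lemma transpose_step_matrix_bounded_below:
  "(a / (a + \<alpha>)) * norm x \<le> norm (transpose (B t) *v x)"
proof -
  have "norm (h *\<^sub>R (A t *v (C t *v x))) \<le> h * ((a + \<alpha>) * (E t * norm x))"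
    using h a \<alpha> norm_ens_cov_le[of J "z t" x] 
    by (auto intro!: mult_left_mono order_trans[OF norm_A_le])
  also have "\<dots> \<le> (\<alpha> / (a + \<alpha>)) * norm x"
  proof -
    have "h * (a + \<alpha>) * E t \<le> \<alpha> / (a + \<alpha>)"
      using small_step[of t] a \<alpha> by (simp add: pos_le_divide_eq power2_eq_square mult_ac)
    then show ?thesis by (metis mult_right_mono norm_ge_zero mult.assoc)
  qed
  finally have "norm x - (\<alpha> / (a + \<alpha>)) * norm x \<le> norm (x - h *\<^sub>R (A t *v (C t *v x)))"
    using norm_triangle_ineq2[of x "h *\<^sub>R (A t *v (C t *v x))"] by linarith
  moreover have "norm x - (\<alpha> / (a + \<alpha>)) * norm x = (a / (a + \<alpha>)) * norm x"
    using a \<alpha> by (simp add: field_simps)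
  ultimately show ?thesis
    by (simp add: transpose_step_matrix_mult transpose_ens_cov)
qed

lemma invertible_transpose_step_matrix: "invertible (transpose (B t))"
proof -
  have "inj ((*v) (transpose (B t)))"
  proof (rule injI)
    fix x y assume "transpose (B t) *v x = transpose (B t) *v y"
    then have "transpose (B t) *v (x - y) = 0" by (simp add: matrix_vector_mult_diff_distrib)
    then have "(a / (a + \<alpha>)) * norm (x - y) \<le> 0"
      using transpose_step_matrix_bounded_below[of "x - y" t] by simp
    then show "x = y" using a \<alpha> by (simp add: mult_le_0_iff divide_le_0_iff)
  qed
  then show ?thesis
    using matrix_left_invertible_injective invertible_left_inverse by blast
qed

lemma step_matrix_right_inverse: "transpose (B t) ** matrix_inv (transpose (B t)) = mat 1"
  using invertible_transpose_step_matrix[of t] by (rule matrix_inv_right)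

lemma norm_inverse_step_le:
  "norm (matrix_inv (transpose (B t)) *v x) \<le> ((a + \<alpha>) / a) * norm x"
proof -
  have "transpose (B t) *v (matrix_inv (transpose (B t)) *v x) = x"
    by (simp add: matrix_vector_mul_assoc step_matrix_right_inverse)
  then show ?thesis
    using transpose_step_matrix_bounded_below[of "matrix_inv (transpose (B t)) *v x" t] a \<alpha>
    by (simp add: field_simps)
qed

lemma norm_S_le: "norm (S (Suc t) *v x) \<le> sqrt a * norm x"
  by (intro norm_forward_le forward_bound) simp

lemma norm_transpose_S_le: "norm (transpose (S (Suc t)) *v x) \<le> sqrt a * norm x"
  by (rule norm_transpose_mult_le[OF norm_S_le])

text \<open>Since \<open>C B\<^sup>T = B C\<close>, one has \<open>C\<^sub>t = C\<^sub>t B\<^sub>t\<^sup>T (B\<^sub>t\<^sup>T)\<^sup>-\<^sup>1 = B\<^sub>t C\<^sub>t (B\<^sub>t\<^sup>T)\<^sup>-\<^sup>1\<close>, and inserting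
  \<open>C\<^sub>t = P\<^sub>t C\<^sub>0 P\<^sub>t\<^sup>T\<close> exhibits the factor \<open>B\<^sub>t P\<^sub>t = P\<^sub>t\<^sub>+\<^sub>1\<close> on the left.\<close>

lemma propagator_gain:
  "P (Suc t) ** gain J \<alpha> h S z t = h *\<^sub>R (C t ** transpose (S (Suc t)))"
proof -
  have comm: "C t ** transpose (B t) = B t ** C t"
    by (simp add: step_matrix_def transpose_diff transpose_scaleR matrix_transpose_mul
        transpose_ens_cov transpose_reg_hessian matrix_eq matrix_vector_mul_assoc[symmetric]
        matrix_vector_mult_diff_distrib matrix_vector_mult_diff_rdistrib scaleR_matrix_vector
        matrix_vector_mult_scaleR)
  have "C t = C t ** (transpose (B t) ** matrix_inv (transpose (B t)))"
    by (simp add: step_matrix_right_inverse)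
  also have "\<dots> = B t ** (P t ** C 0 ** transpose (P t)) ** matrix_inv (transpose (B t))"
    by (simp add: matrix_mul_assoc comm cov_propagator[symmetric])
  finally have "C t = P (Suc t) ** (C 0 ** transpose (P t) ** matrix_inv (transpose (B t)))"
    by (simp add: matrix_mul_assoc)
  then have "C t ** transpose (S (Suc t)) =
      P (Suc t) ** (C 0 ** transpose (P t) ** matrix_inv (transpose (B t)) ** transpose (S (Suc t)))"
    by (metis matrix_mul_assoc)
  then show ?thesis
    unfolding gain_def 
    by (simp add: matrix_eq matrix_vector_mul_assoc[symmetric] scaleR_matrix_vector
        matrix_vector_mult_scaleR)
qed

text \<open>Variation of constants. The propagator carries the old sum along, and \<open>propagator_gain\<close> says that it
  maps the new summand to the contribution of the new observation.\<close>

lemma mean_representation: "zbar t = P t *v (zbar 0 + response J \<alpha> h S z u t)"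
proof (induction t)
  case (Suc t)
  have "P (Suc t) *v (gain J \<alpha> h S z t *v u (Suc t)) = h *\<^sub>R (C t *v (transpose (S (Suc t)) *v u (Suc t)))"
    unfolding matrix_vector_mul_assoc[of "P (Suc t)"] propagator_gain
    by (simp only: scaleR_matrix_vector matrix_vector_mul_assoc)
  then have "zbar (Suc t) = B t *v zbar t + P (Suc t) *v (gain J \<alpha> h S z t *v u (Suc t))"
    by (simp only: mean_step)
  also have "B t *v zbar t = P (Suc t) *v (zbar 0 + response J \<alpha> h S z u t)"
    by (subst Suc) (simp add: matrix_vector_mul_assoc)
  finally show ?case 
    by (simp add: matrix_vector_right_distrib add.assoc del: propagator.simps)
qed simp

definition gain_bound :: real where
  "gain_bound = h * \<kappa> * sqrt (\<kappa> / \<sigma>) * ((a + \<alpha>) / a) * sqrt a"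

lemma gain_bound_nonneg: "0 \<le> gain_bound"
  using h \<kappa>_pos \<sigma> a \<alpha> by (simp add: gain_bound_def)

lemma norm_gain_le: "norm (gain J \<alpha> h S z t *v x) \<le> gain_bound / sqrt (real t + 1) * norm x"
proof -
  let ?w = "transpose (S (Suc t)) *v x"
  let ?q = "matrix_inv (transpose (B t)) *v ?w"
  have "norm (gain J \<alpha> h S z t *v x) = h * norm (C 0 *v (transpose (P t) *v ?q))"
    using h by (simp add: gain_def scaleR_matrix_vector matrix_vector_mul_assoc matrix_mul_assoc)
  also have "\<dots> \<le> h * (\<kappa> * (sqrt (\<kappa> / \<sigma>) / sqrt (real t + 1) * (((a + \<alpha>) / a) * (sqrt a * norm x))))"
  proof (rule mult_left_mono)
    have "norm (C 0 *v (transpose (P t) *v ?q)) \<le> E 0 * norm (transpose (P t) *v ?q)"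
      by (rule norm_ens_cov_le)
    also have "\<dots> \<le> \<kappa> * norm (transpose (P t) *v ?q)"
      by (intro mult_right_mono \<kappa>_init) auto
    also have "\<dots> \<le> \<kappa> * (sqrt (\<kappa> / \<sigma>) / sqrt (real t + 1) * norm ?q)"
      using \<kappa>_pos by (intro mult_left_mono norm_transpose_propagator_le) auto
    also have "\<dots> \<le> \<kappa> * (sqrt (\<kappa> / \<sigma>) / sqrt (real t + 1) * (((a + \<alpha>) / a) * norm ?w))"
      using \<kappa>_pos \<sigma> by (intro mult_left_mono norm_inverse_step_le) auto
    also have "\<dots> \<le> \<kappa> * (sqrt (\<kappa> / \<sigma>) / sqrt (real t + 1) * (((a + \<alpha>) / a) * (sqrt a * norm x)))"
      using \<kappa>_pos \<sigma> a \<alpha> by (intro mult_left_mono norm_transpose_S_le) auto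
    finally show "norm (C 0 *v (transpose (P t) *v ?q)) \<le> \<dots>" .
  qed (use h in simp)
  finally show ?thesis by (simp add: gain_bound_def mult_ac)
qed

text \<open>The gains are \<open>O(1 / \<surd>t)\<close> and the signal \<open>S\<^sub>t x\<close> is bounded.\<close>

lemma norm_signal_response_le:
  "norm (response J \<alpha> h S z (\<lambda>t. S t *v x) t) \<le> 2 * (gain_bound * sqrt a * norm x) * sqrt (real t)"
proof (induction t)
  case (Suc t)
  have "norm (gain J \<alpha> h S z t *v (S (Suc t) *v x)) \<le> gain_bound / sqrt (real t + 1) * (sqrt a * norm x)"
    using gain_bound_nonneg
    by (intro order_trans[OF norm_gain_le] mult_left_mono norm_S_le) auto
  then have "norm (response J \<alpha> h S z (\<lambda>t. S t *v x) (Suc t))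
      \<le> (gain_bound * sqrt a * norm x) * (2 * sqrt (real t) + 1 / sqrt (real t + 1))"
    using norm_triangle_ineq[of "response J \<alpha> h S z (\<lambda>t. S t *v x) t" "gain J \<alpha> h S z t *v (S (Suc t) *v x)"] Suc
    by (simp add: algebra_simps)
  also have "\<dots> \<le> (gain_bound * sqrt a * norm x) * (2 * sqrt (real t + 1))"
    using gain_bound_nonneg a by (intro mult_left_mono sqrt_increment) auto
  finally show ?case by (simp add: mult_ac add.commute)
qed simp

text \<open>In the representation of the mean, the propagator divides by \<open>\<surd>(t + 1)\<close>. This absorbs the growth
  of the signal response and leaves the normalised noise response as the only unbounded term.\<close>

lemma norm_mean_le:
  assumes obs: "\<And>t. u t = S t *v x + w t"
  shows "norm (zbar t) \<le> sqrt (\<kappa> / \<sigma>) * (norm (zbar 0) + 2 * (gain_bound * sqrt a * norm x)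
           + norm (response J \<alpha> h S z w t) / sqrt (real t + 1))"
proof -
  let ?s = "2 * (gain_bound * sqrt a * norm x)"
  have s: "0 \<le> ?s" using gain_bound_nonneg a by simp
  have u: "u = (\<lambda>t. S t *v x + w t)" using obs by auto
  have "norm (zbar t) \<le> sqrt (\<kappa> / \<sigma>) / sqrt (real t + 1) *
      norm (zbar 0 + (response J \<alpha> h S z (\<lambda>t. S t *v x) t + response J \<alpha> h S z w t))"
    by (subst mean_representation) (simp only: u response_add norm_propagator_le)
  also have "\<dots> \<le> sqrt (\<kappa> / \<sigma>) / sqrt (real t + 1) *
      (norm (zbar 0) * sqrt (real t + 1) + ?s * sqrt (real t + 1) + norm (response J \<alpha> h S z w t))"
  proof (rule mult_left_mono)
    have "norm (zbar 0) * 1 \<le> norm (zbar 0) * sqrt (real t + 1)"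
      by (intro mult_left_mono) auto
    moreover have "?s * sqrt (real t) \<le> ?s * sqrt (real t + 1)"
      using s by (intro mult_left_mono) auto
    ultimately show "norm (zbar 0 + (response J \<alpha> h S z (\<lambda>t. S t *v x) t + response J \<alpha> h S z w t))
      \<le> norm (zbar 0) * sqrt (real t + 1) + ?s * sqrt (real t + 1) + norm (response J \<alpha> h S z w t)"
      using norm_signal_response_le[of x t]
        norm_triangle_ineq[of "zbar 0" "response J \<alpha> h S z (\<lambda>t. S t *v x) t + response J \<alpha> h S z w t"]
        norm_triangle_ineq[of "response J \<alpha> h S z (\<lambda>t. S t *v x) t" "response J \<alpha> h S z w t"]
      by linarith
  qed (use \<kappa>_pos \<sigma> in auto)
  also have "\<dots> = sqrt (\<kappa> / \<sigma>) * (norm (zbar 0) + ?s + norm (response J \<alpha> h S z w t) / sqrt (real t + 1))"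
    by (simp add: field_simps)
  finally show ?thesis .
qed

text \<open>The increment is \<open>h C\<^sub>t\<close> applied to a vector, and \<open>C\<^sub>t\<close> is as small as the spread.\<close>

lemma norm_mean_increment_le:
  assumes obs: "\<And>t. u t = S t *v x + w t"
  shows "norm (zbar (Suc t) - zbar t) \<le>
    h * \<kappa> / (real t + 1) * ((a + \<alpha>) * norm (zbar t) + a * norm x + sqrt a * norm (w (Suc t)))"
proof -
  let ?b = "transpose (S (Suc t)) *v u (Suc t) - A t *v zbar t"
  have "zbar (Suc t) - zbar t = h *\<^sub>R (C t *v ?b)"
    by (simp add: mean_step step_matrix_mult matrix_vector_mult_diff_distrib scaleR_diff_right)
  then have "norm (zbar (Suc t) - zbar t) = h * norm (C t *v ?b)"
    using h by simp
  also have "\<dots> \<le> h * (\<kappa> / (real t + 1) * norm ?b)"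
    using h by (intro mult_left_mono order_trans[OF norm_ens_cov_le] mult_right_mono spread_decay) auto
  also have "\<dots> \<le> h * (\<kappa> / (real t + 1) *
      ((a + \<alpha>) * norm (zbar t) + a * norm x + sqrt a * norm (w (Suc t))))"
  proof (intro mult_left_mono)
    have "norm (transpose (S (Suc t)) *v u (Suc t)) \<le> sqrt a * norm (u (Suc t))"
      by (rule norm_transpose_S_le)
    also have "\<dots> \<le> sqrt a * (sqrt a * norm x + norm (w (Suc t)))"
      using a unfolding obs
      by (intro mult_left_mono order_trans[OF norm_triangle_ineq] add_right_mono norm_S_le) auto
    also have "\<dots> = a * norm x + sqrt a * norm (w (Suc t))"
      using a by (simp add: distrib_left flip: mult.assoc)
    finally show "norm ?b \<le> (a + \<alpha>) * norm (zbar t) + a * norm x + sqrt a * norm (w (Suc t))"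
      using norm_triangle_ineq4[of "transpose (S (Suc t)) *v u (Suc t)" "A t *v zbar t"]
        norm_A_le[of t "zbar t"] by linarith
  qed (use h \<kappa>_pos in auto)
  finally show ?thesis by simp
qed

end

section \<open>Measurability of matrix operations\<close>

lemma borel_measurable_vec_iff:
  fixes f :: "'a \<Rightarrow> ('b::euclidean_space)^'n"
  shows "f \<in> borel_measurable M \<longleftrightarrow> (\<forall>i. (\<lambda>x. f x $ i) \<in> borel_measurable M)"
proof
  assume "f \<in> borel_measurable M"
  then show "\<forall>i. (\<lambda>x. f x $ i) \<in> borel_measurable M"
    by (auto intro!: borel_measurable_continuous_on[of "\<lambda>v. v $ _"] continuous_intros)
next
  assume "\<forall>i. (\<lambda>x. f x $ i) \<in> borel_measurable M"
  then have "(\<lambda>x. f x $ i \<bullet> b) \<in> borel_measurable M" for i b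
    by (intro borel_measurable_inner) auto
  then show "f \<in> borel_measurable M"
    by (subst borel_measurable_euclidean_space) (auto simp: Basis_vec_def inner_axis)
qed

lemma borel_measurable_vec_nth [measurable (raw)]:
  fixes f :: "'a \<Rightarrow> ('b::euclidean_space)^'n"
  shows "f \<in> borel_measurable M \<Longrightarrow> (\<lambda>x. f x $ i) \<in> borel_measurable M"
  by (simp add: borel_measurable_vec_iff)

lemma borel_measurable_vec_lambda [measurable (raw)]:
  fixes f :: "'a \<Rightarrow> 'n::finite \<Rightarrow> ('b::euclidean_space)"
  shows "(\<And>i. (\<lambda>x. f x i) \<in> borel_measurable M) \<Longrightarrow> (\<lambda>x. \<chi> i. f x i) \<in> borel_measurable M"
  by (simp add: borel_measurable_vec_iff)

lemma borel_measurable_matrix_vector_mult [measurable (raw)]: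
  fixes A :: "'a \<Rightarrow> real^'n^'m"
  assumes [measurable]: "A \<in> borel_measurable M" "v \<in> borel_measurable M"
  shows "(\<lambda>x. A x *v v x) \<in> borel_measurable M"
  unfolding matrix_vector_mult_def by measurable

lemma borel_measurable_matrix_mult [measurable (raw)]:
  fixes A :: "'a \<Rightarrow> real^'n^'m" and B :: "'a \<Rightarrow> real^'k^'n"
  assumes [measurable]: "A \<in> borel_measurable M" "B \<in> borel_measurable M"
  shows "(\<lambda>x. A x ** B x) \<in> borel_measurable M"
  unfolding matrix_matrix_mult_def by measurable

lemma borel_measurable_transpose [measurable (raw)]:
  fixes A :: "'a \<Rightarrow> real^'n^'m"
  assumes [measurable]: "A \<in> borel_measurable M"
  shows "(\<lambda>x. transpose (A x)) \<in> borel_measurable M"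
  unfolding transpose_def by measurable

lemma borel_measurable_det [measurable (raw)]:
  fixes A :: "'a \<Rightarrow> real^'n^'n"
  assumes [measurable]: "A \<in> borel_measurable M"
  shows "(\<lambda>x. det (A x)) \<in> borel_measurable M"
  unfolding det_def by measurable

text \<open>Cramer's rule as an equation for all matrices. Singular matrices share one unspecified
  \<open>matrix_inv\<close>, here named \<open>matrix_inv 0\<close>; so inversion is a piecewise rational function of the
  entries and therefore Borel measurable.\<close>

lemma matrix_inv_cramer:
  fixes A :: "real^'n^'n"
  shows "matrix_inv A = (if det A = 0 then matrix_inv 0 else
    (\<chi> i k. det (\<chi> r c. if c = i then axis k 1 $ r else A $ r $ c) / det A))"
proof (cases "det A = 0")
  case True
  have default: "matrix_inv X = (SOME _. False)" if "\<not> invertible X" for X :: "real^'n^'n"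
    using that by (auto simp: matrix_inv_def invertible_def intro: arg_cong[where f = Eps])
  from True have "\<not> invertible A" by (simp add: invertible_det_nz)
  moreover have "\<not> invertible (0 :: real^'n^'n)"
    by (simp add: invertible_det_nz det_zero_row(1)[of undefined] row_def vec_eq_iff)
  ultimately show ?thesis 
    using True default by metis
next
  case False
  then have "invertible A" by (simp add: invertible_det_nz)
  then have "A *v (matrix_inv A *v axis k 1) = axis k 1" for k
    by (simp add: matrix_vector_mul_assoc matrix_inv_right)
  then have "matrix_inv A *v axis k 1
      = (\<chi> i. det (\<chi> r c. if c = i then axis k 1 $ r else A $ r $ c) / det A)" for k
    by (rule cramer[OF False, THEN iffD1])
  then have "(matrix_inv A *v axis k 1) $ i
      = det (\<chi> r c. if c = i then axis k 1 $ r else A $ r $ c) / det A" for i k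
    by simp
  then show ?thesis 
    using False by (simp add: vec_eq_iff matrix_vector_mul_component inner_axis)
qed

lemma borel_measurable_matrix_inv [measurable (raw)]:
  fixes A :: "'a \<Rightarrow> real^'n^'n"
  assumes [measurable]: "A \<in> borel_measurable M"
  shows "(\<lambda>x. matrix_inv (A x)) \<in> borel_measurable M"
  by (subst matrix_inv_cramer) measurable

lemma borel_measurable_step_matrix [measurable (raw)]:
  assumes [measurable]: "C \<in> borel_measurable M" "S \<in> borel_measurable M"
  shows "(\<lambda>x. step_matrix h \<alpha> (C x) (S x)) \<in> borel_measurable M"
  unfolding step_matrix_def reg_hessian_def by measurable

lemma borel_measurable_ens_mean:
  assumes [measurable]: "\<And>j. j \<in> {1..J} \<Longrightarrow> (\<lambda>x. z x j) \<in> borel_measurable M"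
  shows "(\<lambda>x. ens_mean J (z x)) \<in> borel_measurable M"
  unfolding ens_mean_def by (intro borel_measurable_scaleR borel_measurable_sum) auto

lemma borel_measurable_ens_cov:
  assumes "\<And>j. j \<in> {1..J} \<Longrightarrow> (\<lambda>x. z x j) \<in> borel_measurable M"
  shows "(\<lambda>x. ens_cov J (z x)) \<in> borel_measurable M"
proof -
  have "(\<lambda>x. outer_product (z x j - ens_mean J (z x)) (z x j - ens_mean J (z x))) \<in> borel_measurable M"
    if "j \<in> {1..J}" for j
    unfolding outer_product_def
    by (intro borel_measurable_vec_lambda borel_measurable_times borel_measurable_vec_nth
        borel_measurable_diff borel_measurable_ens_mean assms that)
  then show ?thesis unfolding ens_cov_def by (intro borel_measurable_scaleR borel_measurable_sum) auto
qed

text \<open>The gain at time \<open>t\<close> involves the ensembles up to time \<open>t\<close> only. This is recorded because the gain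
  has to be independent of the noise that it multiplies, which enters at time \<open>t + 1\<close>.\<close>

lemma borel_measurable_gain:
  assumes z: "\<And>s j. s \<le> t \<Longrightarrow> j \<in> {1..J} \<Longrightarrow> (\<lambda>x. z x s j) \<in> borel_measurable M"
    and S: "\<And>s. 1 \<le> s \<Longrightarrow> (\<lambda>x. S x s) \<in> borel_measurable M"
  shows "(\<lambda>x. gain J \<alpha> h (S x) (z x) t) \<in> borel_measurable M"
proof -
  have C: "(\<lambda>x. ens_cov J (z x s)) \<in> borel_measurable M" if "s \<le> t" for s
    by (intro borel_measurable_ens_cov z that)
  have P: "(\<lambda>x. propagator J \<alpha> h (S x) (z x) s) \<in> borel_measurable M" if "s \<le> Suc t" for s
    using that
  proof (induction s)
    case (Suc s)
    then show ?case
      by (auto intro!: borel_measurable_matrix_mult borel_measurable_step_matrix C S)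
  qed simp
  show ?thesis
    unfolding gain_def
    by (intro borel_measurable_scaleR borel_measurable_matrix_mult borel_measurable_transpose
        borel_measurable_matrix_inv borel_measurable_step_matrix borel_measurable_const C P S) auto
qed

lemma borel_measurable_response:
  assumes z: "\<And>s j. s < t \<Longrightarrow> j \<in> {1..J} \<Longrightarrow> (\<lambda>x. z x s j) \<in> borel_measurable M"
    and S: "\<And>s. 1 \<le> s \<Longrightarrow> (\<lambda>x. S x s) \<in> borel_measurable M"
    and w: "\<And>s. 1 \<le> s \<Longrightarrow> s \<le> t \<Longrightarrow> (\<lambda>x. w x s) \<in> borel_measurable M"
  shows "(\<lambda>x. response J \<alpha> h (S x) (z x) (w x) t) \<in> borel_measurable M"
proof -
  have "(\<lambda>x. response J \<alpha> h (S x) (z x) (w x) s) \<in> borel_measurable M" if "s \<le> t" for s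
    using that
  proof (induction s)
    case (Suc s)
    then have "(\<lambda>x. gain J \<alpha> h (S x) (z x) s) \<in> borel_measurable M"
      by (intro borel_measurable_gain z S) auto
    then show ?case
      using Suc w by (auto intro!: borel_measurable_add borel_measurable_matrix_vector_mult)
  qed simp
  then show ?thesis by simp
qed

section \<open>Gaussian noise\<close>

text \<open>The form of \<open>\<Gamma>\<^sup>-\<^sup>1\<close> is positive off \<open>0\<close>, as is seen by substituting \<open>x = \<Gamma> y\<close>, and it attains its
  minimum on the compact unit sphere.\<close>

lemma pos_def_inverse_coercive:
  assumes "pos_def_matrix \<Gamma>"
  shows "\<exists>l>0. \<forall>x. l * (norm x)\<^sup>2 \<le> x \<bullet> (matrix_inv \<Gamma> *v x)"
proof -
  have pd: "0 < x \<bullet> (\<Gamma> *v x)" if "x \<noteq> 0" for x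
    using assms that by (auto simp: pos_def_matrix_def)
  have "inj ((*v) \<Gamma>)"
  proof (rule injI)
    fix x y assume "\<Gamma> *v x = \<Gamma> *v y"
    then have "\<Gamma> *v (x - y) = 0" by (simp add: matrix_vector_mult_diff_distrib)
    then show "x = y" using pd[of "x - y"] by force
  qed
  then have inv: "invertible \<Gamma>"
    using matrix_left_invertible_injective invertible_left_inverse by blast
  have pos: "0 < x \<bullet> (matrix_inv \<Gamma> *v x)" if "x \<noteq> 0" for x
  proof -
    have x: "x = \<Gamma> *v (matrix_inv \<Gamma> *v x)"
      by (simp add: matrix_vector_mul_assoc matrix_inv_right[OF inv])
    then have "matrix_inv \<Gamma> *v x \<noteq> 0" using that by force
    from pd[OF this] show ?thesis using x by (simp add: inner_commute)
  qed
  have "\<exists>x0\<in>sphere 0 1. \<forall>x\<in>sphere 0 1. x0 \<bullet> (matrix_inv \<Gamma> *v x0) \<le> x \<bullet> (matrix_inv \<Gamma> *v x)"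
    by (intro continuous_attains_inf continuous_intros matrix_vector_mult_linear_continuous_on) auto
  then obtain x0 where x0: "norm x0 = 1"
    and min: "\<And>x. norm x = 1 \<Longrightarrow> x0 \<bullet> (matrix_inv \<Gamma> *v x0) \<le> x \<bullet> (matrix_inv \<Gamma> *v x)"
    by auto
  show ?thesis
  proof (intro exI conjI allI)
    show "0 < x0 \<bullet> (matrix_inv \<Gamma> *v x0)" using x0 by (intro pos) auto
    fix x
    show "x0 \<bullet> (matrix_inv \<Gamma> *v x0) * (norm x)\<^sup>2 \<le> x \<bullet> (matrix_inv \<Gamma> *v x)"
    proof (cases "x = 0")
      case False
      have "x0 \<bullet> (matrix_inv \<Gamma> *v x0) \<le> (x /\<^sub>R norm x) \<bullet> (matrix_inv \<Gamma> *v (x /\<^sub>R norm x))"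
        using False by (intro min) simp
      also have "\<dots> = (x \<bullet> (matrix_inv \<Gamma> *v x)) / (norm x)\<^sup>2"
        by (simp add: matrix_vector_mult_scaleR power2_eq_square field_simps)
      finally show ?thesis using False by (simp add: pos_le_divide_eq)
    qed simp
  qed
qed

text \<open>The integrand is a product over the coordinates, and each factor is a multiple of a normal
  density.\<close>

lemma nn_integral_exp_neg_norm_square_finite:
  assumes c: "0 < c"
  shows "(\<integral>\<^sup>+x. ennreal (exp (- c * (norm (x::'a::euclidean_space))\<^sup>2)) \<partial>lborel) < \<infinity>"
proof -
  have 1: "(\<integral>\<^sup>+t. ennreal (exp (- c * t\<^sup>2)) \<partial>lborel) < \<infinity>"
  proof -
    define s where "s = 1 / sqrt (2 * c)"
    have s: "0 < s" "2 * s\<^sup>2 = 1 / c" using c by (auto simp: s_def power_divide)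
    have "exp (- c * t\<^sup>2) = sqrt (2 * pi * s\<^sup>2) * normal_density 0 s t" for t
      using s c by (simp add: normal_density_def field_simps)
    then have "integrable lborel (\<lambda>t. exp (- c * t\<^sup>2))"
      using s by simp
    then show ?thesis
      by (simp add: integrable_iff_bounded)
  qed
  have "exp (- c * (norm x)\<^sup>2) = (\<Prod>b\<in>Basis. exp (- c * (x \<bullet> b)\<^sup>2))" for x :: 'a
    unfolding power2_norm_eq_inner euclidean_inner[of x x]
    by (simp add: exp_sum[symmetric] sum_distrib_left sum_negf power2_eq_square)
  then have "(\<integral>\<^sup>+x. ennreal (exp (- c * (norm (x::'a))\<^sup>2)) \<partial>lborel)
      = (\<integral>\<^sup>+x. (\<Prod>b\<in>Basis. ennreal (exp (- c * ((x::'a) \<bullet> b)\<^sup>2))) \<partial>lborel)"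
    by (simp add: prod_ennreal)
  also have "\<dots> = (\<Prod>b\<in>(Basis::'a set). (\<integral>\<^sup>+t. ennreal (exp (- c * t\<^sup>2)) \<partial>lborel))"
    by (rule nn_integral_lborel_prod) auto
  also have "\<dots> < \<infinity>" using 1 by (simp add: power_less_top_ennreal)
  finally show ?thesis .
qed

lemma borel_measurable_gaussian_density [measurable]:
  "gaussian_density \<Gamma> \<in> borel_measurable borel"
  unfolding gaussian_density_def[abs_def] by measurable

abbreviation gaussian :: "real^'p^'p \<Rightarrow> (real^'p) measure" where
  "gaussian \<Gamma> \<equiv> density lborel (\<lambda>x. ennreal (gaussian_density \<Gamma> x))"

text \<open>The density is at most \<open>K exp (- l |x|\<^sup>2 / 2)\<close>. Half of the exponent pays for the factor \<open>|x|\<^sup>2\<close>, by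
  \<open>y \<le> exp y\<close>, and the other half is integrable.\<close>

lemma gaussian_second_moment:
  assumes "pos_def_matrix \<Gamma>"
  shows "integrable (gaussian \<Gamma>) (\<lambda>x. (norm x)\<^sup>2)"
proof (rule integrableI_bounded)
  obtain l where l: "0 < l" "\<And>x. l * (norm x)\<^sup>2 \<le> x \<bullet> (matrix_inv \<Gamma> *v x)"
    using pos_def_inverse_coercive[OF assms] by metis
  define K where "K = \<bar>1 / sqrt ((2 * pi) ^ CARD('a) * det \<Gamma>)\<bar>"
  have bound: "gaussian_density \<Gamma> x * (norm x)\<^sup>2 \<le> K * (4 / l) * exp (- (l / 4) * (norm x)\<^sup>2)" for x
  proof -
    have "gaussian_density \<Gamma> x \<le> K * exp (- (x \<bullet> (matrix_inv \<Gamma> *v x)) / 2)"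
      using mult_right_mono[OF abs_ge_self[of "1 / sqrt ((2 * pi) ^ CARD('a) * det \<Gamma>)"],
          of "exp (- (x \<bullet> (matrix_inv \<Gamma> *v x)) / 2)"]
      by (simp add: gaussian_density_def K_def)
    also have "\<dots> \<le> K * exp (- l * (norm x)\<^sup>2 / 2)"
      using l(2)[of x] by (intro mult_left_mono) (auto simp: K_def)
    finally have "gaussian_density \<Gamma> x * (norm x)\<^sup>2 \<le> K * exp (- l * (norm x)\<^sup>2 / 2) * (norm x)\<^sup>2"
      by (intro mult_right_mono) auto
    also have "\<dots> \<le> K * exp (- l * (norm x)\<^sup>2 / 2) * ((4 / l) * exp (l / 4 * (norm x)\<^sup>2))"
    proof (intro mult_left_mono)
      show "(norm x)\<^sup>2 \<le> (4 / l) * exp (l / 4 * (norm x)\<^sup>2)"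
        using exp_ge_add_one_self[of "l / 4 * (norm x)\<^sup>2"] l(1) by (simp add: field_simps)
    qed (auto simp: K_def)
    also have "\<dots> = K * (4 / l) * (exp (- l * (norm x)\<^sup>2 / 2) * exp (l / 4 * (norm x)\<^sup>2))"
      by simp
    also have "\<dots> = K * (4 / l) * exp (- (l / 4) * (norm x)\<^sup>2)"
      unfolding exp_add[symmetric] by (simp add: algebra_simps)
    finally show ?thesis .
  qed
  have "(\<integral>\<^sup>+x. ennreal (norm ((norm x)\<^sup>2)) \<partial>gaussian \<Gamma>)
      = (\<integral>\<^sup>+x. ennreal (gaussian_density \<Gamma> x) * ennreal ((norm x)\<^sup>2) \<partial>lborel)"
    by (simp add: nn_integral_density)
  also have "\<dots> \<le> (\<integral>\<^sup>+x. ennreal (K * (4 / l)) * ennreal (exp (- (l / 4) * (norm (x::real^'a))\<^sup>2)) \<partial>lborel)"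
    using l(1) bound
    by (intro nn_integral_mono) (auto simp: ennreal_mult''[symmetric] K_def intro!: ennreal_leI)
  also have "\<dots> = ennreal (K * (4 / l)) * (\<integral>\<^sup>+x. ennreal (exp (- (l / 4) * (norm (x::real^'a))\<^sup>2)) \<partial>lborel)"
    by (rule nn_integral_cmult) simp
  also have "\<dots> < \<infinity>"
    using nn_integral_exp_neg_norm_square_finite[of "l / 4", where 'a = "real^'a"] l(1)
    by (simp add: ennreal_mult_less_top less_top)
  finally show "(\<integral>\<^sup>+x. ennreal (norm ((norm x)\<^sup>2)) \<partial>gaussian \<Gamma>) < \<infinity>" .
qed simp

lemma lborel_integral_reflect:
  fixes f :: "'a::euclidean_space \<Rightarrow> real"
  assumes [measurable]: "f \<in> borel_measurable borel"
  shows "(\<integral>x. f (- x) \<partial>lborel) = (\<integral>x. f x \<partial>lborel)"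
proof -
  have "(lborel :: 'a measure) = distr lborel borel (\<lambda>x. - x)"
    using lborel_affine[of "-1" "0::'a"] by (simp add: density_1)
  then have "(\<integral>x. f x \<partial>lborel) = (\<integral>x. f x \<partial>distr lborel borel (\<lambda>x. - x))" by simp
  then show ?thesis by (simp add: integral_distr)
qed

text \<open>The density is even. Only its positive part enters the measure, so the reflection argument is run
  with that part; this makes the identity hold for every \<open>\<Gamma>\<close>.\<close>

lemma gaussian_mean_zero: "(\<integral>x. x $ i \<partial>gaussian \<Gamma>) = 0"
proof -
  define g where "g x = max 0 (gaussian_density \<Gamma> x)" for x
  have g [measurable]: "g \<in> borel_measurable borel" unfolding g_def by measurable
  have sym: "g (- x) = g x" for x
    by (simp add: g_def gaussian_density_def vec.neg)
  have "gaussian \<Gamma> = density lborel (\<lambda>x. ennreal (g x))"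
    by (simp add: g_def ennreal_max_0)
  then have I: "(\<integral>x. x $ i \<partial>gaussian \<Gamma>) = (\<integral>x. g x * x $ i \<partial>lborel)"
    by (simp only:) (subst integral_density, auto simp: g_def)
  have "(\<integral>x. g x * x $ i \<partial>lborel) = (\<integral>x. - (g x * x $ i) \<partial>lborel)"
    using lborel_integral_reflect[of "\<lambda>x. g x * x $ i"] by (simp add: sym)
  then show ?thesis unfolding I by simp
qed

lemma (in prob_space) gaussian_random_vector:
  assumes X: "distributed M lborel X (\<lambda>x. ennreal (gaussian_density \<Gamma> x))"
    and \<Gamma>: "pos_def_matrix \<Gamma>"
  shows "integrable M (\<lambda>\<omega>. (norm (X \<omega>))\<^sup>2)"
    and "expectation (\<lambda>\<omega>. (norm (X \<omega>))\<^sup>2) = (\<integral>x. (norm x)\<^sup>2 \<partial>gaussian \<Gamma>)"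
    and "expectation (\<lambda>\<omega>. X \<omega> $ i) = 0"
proof -
  have [measurable]: "X \<in> borel_measurable M"
    using distributed_measurable[OF X] by simp
  have d: "distr M lborel X = gaussian \<Gamma>"
    by (rule distributed_distr_eq_density[OF X])
  show "integrable M (\<lambda>\<omega>. (norm (X \<omega>))\<^sup>2)"
    using gaussian_second_moment[OF \<Gamma>] unfolding d[symmetric]
    by (subst (asm) integrable_distr_eq) auto
  show "expectation (\<lambda>\<omega>. (norm (X \<omega>))\<^sup>2) = (\<integral>x. (norm x)\<^sup>2 \<partial>gaussian \<Gamma>)"
    unfolding d[symmetric] by (subst integral_distr) auto
  show "expectation (\<lambda>\<omega>. X \<omega> $ i) = 0"
    unfolding gaussian_mean_zero[where i = i and \<Gamma> = \<Gamma>, symmetric] d[symmetric] by (subst integral_distr) auto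
qed

section \<open>Random walks with step variance of order \<open>1 / t\<close>\<close>

text \<open>Monotone convergence: the infinite sum has finite expectation, hence is finite almost surely, and
  it serves as the bound.\<close>

lemma (in prob_space) integrable_bound_partial_sums:
  fixes y :: "nat \<Rightarrow> 'a \<Rightarrow> real"
  assumes int: "\<And>t. integrable M (y t)" and nonneg: "\<And>t \<omega>. 0 \<le> y t \<omega>"
    and sum: "summable (\<lambda>t. expectation (y t))"
  shows "\<exists>Y. integrable M Y \<and> (\<forall>\<omega>. 0 \<le> Y \<omega>) \<and> (AE \<omega> in M. \<forall>t. (\<Sum>s<t. y s \<omega>) \<le> Y \<omega>)"
proof -
  have [measurable]: "y t \<in> borel_measurable M" for t using int[of t] by simp
  define F where "F \<omega> = (\<Sum>t. ennreal (y t \<omega>))" for \<omega>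
  have [measurable]: "F \<in> borel_measurable M" unfolding F_def by measurable
  have "(\<integral>\<^sup>+\<omega>. F \<omega> \<partial>M) = (\<Sum>t. \<integral>\<^sup>+\<omega>. ennreal (y t \<omega>) \<partial>M)"
    unfolding F_def by (rule nn_integral_suminf) simp
  also have "\<dots> = (\<Sum>t. ennreal (expectation (y t)))"
    by (simp add: nn_integral_eq_integral int nonneg)
  also have "\<dots> = ennreal (\<Sum>t. expectation (y t))"
    by (intro suminf_ennreal2 sum Bochner_Integration.integral_nonneg nonneg)
  finally have fin: "(\<integral>\<^sup>+\<omega>. F \<omega> \<partial>M) < \<infinity>" by simp
  have AE_fin: "AE \<omega> in M. F \<omega> \<noteq> \<infinity>"
    using fin by (intro nn_integral_PInf_AE) auto
  show ?thesis
  proof (intro exI conjI allI)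
    have "(\<integral>\<^sup>+\<omega>. ennreal (norm (enn2real (F \<omega>))) \<partial>M) \<le> (\<integral>\<^sup>+\<omega>. F \<omega> \<partial>M)"
      by (intro nn_integral_mono) (auto simp: enn2real_nonneg ennreal_enn2real_if)
    then show "integrable M (\<lambda>\<omega>. enn2real (F \<omega>))"
      using fin by (intro integrableI_bounded) auto
    show "0 \<le> enn2real (F \<omega>)" for \<omega> by simp
    show "AE \<omega> in M. \<forall>t. (\<Sum>s<t. y s \<omega>) \<le> enn2real (F \<omega>)"
      using AE_fin
    proof eventually_elim
      case (elim \<omega>)
      show ?case
      proof
        fix t
        have "ennreal (\<Sum>s<t. y s \<omega>) = (\<Sum>s<t. ennreal (y s \<omega>))"
          by (rule sum_ennreal[symmetric]) (rule nonneg)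
        also have "\<dots> \<le> F \<omega>"
          unfolding F_def by (rule sum_le_suminf) (rule summableI, auto)
        finally have "enn2real (ennreal (\<Sum>s<t. y s \<omega>)) \<le> enn2real (F \<omega>)"
          by (rule enn2real_mono) (use elim in \<open>simp add: less_top\<close>)
        then show "(\<Sum>s<t. y s \<omega>) \<le> enn2real (F \<omega>)"
          by (subst (asm) enn2real_ennreal) (auto intro: sum_nonneg nonneg)
      qed
    qed
  qed
qed

text \<open>Expand the square and split the cross term by \<open>2 |x| |\<xi>| \<le> |x|\<^sup>2 r\<^sup>-\<^sup>3\<^sup>/\<^sup>4 + |\<xi>|\<^sup>2 r\<^sup>3\<^sup>/\<^sup>4\<close>. The exponent is
  chosen so that, for a walk with \<open>E|x|\<^sup>2 = O(\<surd>r)\<close> and \<open>E|\<xi>|\<^sup>2 = O(1/r)\<close>, both terms of the increment have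
  expectation \<open>O(r\<^sup>-\<^sup>5\<^sup>/\<^sup>4)\<close>, which is summable.\<close>

lemma norm_square_walk_step:
  fixes x \<xi> :: "'a::real_inner" and r :: real
  assumes r: "1 \<le> r"
  shows "(norm (x + \<xi>))\<^sup>2 / (r + 1) \<le> (norm x)\<^sup>2 / r +
    ((norm x)\<^sup>2 * r powr (- 7 / 4) + 2 * (norm \<xi>)\<^sup>2 * r powr (- 1 / 4))"
proof -
  define p where "p = r powr (3 / 8)"
  have p: "0 < p" using r by (simp add: p_def)
  have p2: "p\<^sup>2 = r powr (3 / 4)"
    using r by (simp add: p_def power2_eq_square powr_add[symmetric])
  have "0 \<le> (norm x / p - norm \<xi> * p)\<^sup>2" by simp
  also have "\<dots> = (norm x)\<^sup>2 / p\<^sup>2 + (norm \<xi>)\<^sup>2 * p\<^sup>2 - 2 * norm x * norm \<xi>"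
    using p by (simp add: power2_diff power_divide power_mult_distrib)
  finally have amgm: "2 * norm x * norm \<xi> \<le> (norm x)\<^sup>2 / p\<^sup>2 + (norm \<xi>)\<^sup>2 * p\<^sup>2" by simp
  have "(norm (x + \<xi>))\<^sup>2 \<le> (norm x + norm \<xi>)\<^sup>2"
    by (intro power_mono norm_triangle_ineq) auto
  also have "\<dots> \<le> (norm x)\<^sup>2 + ((norm x)\<^sup>2 / p\<^sup>2 + (norm \<xi>)\<^sup>2 * p\<^sup>2) + (norm \<xi>)\<^sup>2"
    using amgm by (simp add: power2_sum)
  finally have "(norm (x + \<xi>))\<^sup>2 / (r + 1) \<le>
     ((norm x)\<^sup>2 + ((norm x)\<^sup>2 / p\<^sup>2 + (norm \<xi>)\<^sup>2 * p\<^sup>2) + (norm \<xi>)\<^sup>2) / r"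
    using r by (intro frac_le) auto
  also have "\<dots> = (norm x)\<^sup>2 / r + (norm x)\<^sup>2 * (1 / p\<^sup>2 / r) + (norm \<xi>)\<^sup>2 * (p\<^sup>2 / r) + (norm \<xi>)\<^sup>2 * (1 / r)"
    by (simp add: add_divide_distrib)
  also have "1 / p\<^sup>2 / r = r powr (- 7 / 4)"
    using r powr_diff[of r "- 3 / 4" 1] by (simp add: p2 powr_minus_divide)
  also have "p\<^sup>2 / r = r powr (- 1 / 4)"
    using r powr_diff[of r "3 / 4" 1] by (simp add: p2)
  finally have "(norm (x + \<xi>))\<^sup>2 / (r + 1) \<le> (norm x)\<^sup>2 / r + (norm x)\<^sup>2 * r powr (- 7 / 4)
     + (norm \<xi>)\<^sup>2 * r powr (- 1 / 4) + (norm \<xi>)\<^sup>2 * (1 / r)" .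
  moreover have "1 / r \<le> r powr (- 1 / 4)"
    using r powr_mono[of "-1" "- 1 / 4" r] by (simp add: powr_minus_divide)
  then have "(norm \<xi>)\<^sup>2 * (1 / r) \<le> (norm \<xi>)\<^sup>2 * r powr (- 1 / 4)"
    by (intro mult_left_mono) auto
  ultimately show ?thesis by simp
qed

text \<open>Orthogonality of the increments gives \<open>E|N\<^sub>t|\<^sup>2 \<le> c \<Sum> 1 / (s + 1) \<le> 2 c \<surd>t\<close>. By
  \<open>norm_square_walk_step\<close> the sequence \<open>|N\<^sub>t|\<^sup>2 / (t + 1)\<close> is bounded pathwise by the partial sums of
  non-negative variables with summable expectations, so the supremum over \<open>t\<close> is controlled by
  telescoping in place of a maximal inequality.

  Orthogonality is assumed conditionally on \<open>N\<^sub>t\<close> being square integrable: a typical proof of it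
  needs this integrability, which is only established along the induction on \<open>t\<close>.\<close>

lemma (in prob_space) normalized_walk_dominated:
  fixes N \<xi> :: "nat \<Rightarrow> 'a \<Rightarrow> 'v::euclidean_space"
  assumes N0: "\<And>\<omega>. N 0 \<omega> = 0" and NSuc: "\<And>t \<omega>. N (Suc t) \<omega> = N t \<omega> + \<xi> t \<omega>"
    and \<xi>_meas: "\<And>t. \<xi> t \<in> borel_measurable M"
    and \<xi>_int: "\<And>t. integrable M (\<lambda>\<omega>. (norm (\<xi> t \<omega>))\<^sup>2)"
    and \<xi>_le: "\<And>t. expectation (\<lambda>\<omega>. (norm (\<xi> t \<omega>))\<^sup>2) \<le> c / (real t + 1)"
    and orth: "\<And>t. integrable M (\<lambda>\<omega>. (norm (N t \<omega>))\<^sup>2) \<Longrightarrow> expectation (\<lambda>\<omega>. N t \<omega> \<bullet> \<xi> t \<omega>) = 0"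
  shows "\<exists>Y. integrable M Y \<and> (\<forall>\<omega>. 0 \<le> Y \<omega>) \<and>
    (AE \<omega> in M. \<forall>t. (norm (N t \<omega>))\<^sup>2 / (real t + 1) \<le> Y \<omega>)"
proof -
  have "0 \<le> expectation (\<lambda>\<omega>. (norm (\<xi> 0 \<omega>))\<^sup>2)" by simp
  also have "\<dots> \<le> c" using \<xi>_le[of 0] by simp
  finally have c: "0 \<le> c" .
  note [measurable] = \<xi>_meas
  have N_meas [measurable]: "N t \<in> borel_measurable M" for t
  proof (induction t)
    case 0
    have "N 0 = (\<lambda>_. 0)" using N0 by auto
    then show ?case by simp
  next
    case (Suc t)
    note [measurable] = Suc
    have "N (Suc t) = (\<lambda>\<omega>. N t \<omega> + \<xi> t \<omega>)" using NSuc by auto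
    then show ?case by simp
  qed
  have N_int: "integrable M (\<lambda>\<omega>. (norm (N t \<omega>))\<^sup>2) \<and>
      expectation (\<lambda>\<omega>. (norm (N t \<omega>))\<^sup>2) \<le> 2 * c * sqrt (real t)" for t
  proof (induction t)
    case 0
    then show ?case by (simp add: N0)
  next
    case (Suc t)
    then have iN: "integrable M (\<lambda>\<omega>. (norm (N t \<omega>))\<^sup>2)" by simp
    have iX: "integrable M (\<lambda>\<omega>. N t \<omega> \<bullet> \<xi> t \<omega>)"
    proof (rule Bochner_Integration.integrable_bound)
      show "integrable M (\<lambda>\<omega>. (norm (N t \<omega>))\<^sup>2 + (norm (\<xi> t \<omega>))\<^sup>2)"
        using iN \<xi>_int by simp
      have "\<bar>N t \<omega> \<bullet> \<xi> t \<omega>\<bar> \<le> (norm (N t \<omega>))\<^sup>2 + (norm (\<xi> t \<omega>))\<^sup>2" for \<omega>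
      proof -
        have "\<bar>N t \<omega> \<bullet> \<xi> t \<omega>\<bar> \<le> norm (N t \<omega>) * norm (\<xi> t \<omega>)"
          by (rule Cauchy_Schwarz_ineq2)
        moreover have "0 \<le> (norm (N t \<omega>) - norm (\<xi> t \<omega>))\<^sup>2" by simp
        moreover have "0 \<le> norm (N t \<omega>) * norm (\<xi> t \<omega>)" by simp
        ultimately show ?thesis unfolding power2_diff by linarith
      qed
      then show "AE \<omega> in M. norm (N t \<omega> \<bullet> \<xi> t \<omega>) \<le> norm ((norm (N t \<omega>))\<^sup>2 + (norm (\<xi> t \<omega>))\<^sup>2)"
        by simp
    qed simp
    have eq: "(norm (N (Suc t) \<omega>))\<^sup>2 = (norm (N t \<omega>))\<^sup>2 + 2 * (N t \<omega> \<bullet> \<xi> t \<omega>) + (norm (\<xi> t \<omega>))\<^sup>2" for \<omega>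
      by (simp add: NSuc power2_norm_eq_inner inner_add_left inner_add_right inner_commute)
    have "expectation (\<lambda>\<omega>. (norm (N (Suc t) \<omega>))\<^sup>2)
        = expectation (\<lambda>\<omega>. (norm (N t \<omega>))\<^sup>2) + expectation (\<lambda>\<omega>. (norm (\<xi> t \<omega>))\<^sup>2)"
      unfolding eq using iN iX \<xi>_int[of t] orth[OF iN] by simp
    also have "\<dots> \<le> 2 * c * sqrt (real t) + c / (real t + 1)"
      using Suc \<xi>_le[of t] by simp
    also have "\<dots> \<le> c * (2 * sqrt (real t) + 1 / sqrt (real t + 1))"
    proof -
      have "sqrt (real t + 1) \<le> real t + 1"
        by (intro real_le_lsqrt) (auto simp: power2_eq_square)
      then have "1 / (real t + 1) \<le> 1 / sqrt (real t + 1)"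
        by (intro divide_left_mono) auto
      then have "c * (1 / (real t + 1)) \<le> c * (1 / sqrt (real t + 1))"
        using c by (rule mult_left_mono)
      then show ?thesis by (simp add: algebra_simps)
    qed
    also have "\<dots> \<le> c * (2 * sqrt (real t + 1))"
      using c by (intro mult_left_mono sqrt_increment)
    finally show ?case 
      unfolding eq using iN iX \<xi>_int[of t] by (simp add: mult_ac add.commute)
  qed
  define y where "y t \<omega> = (norm (N t \<omega>))\<^sup>2 * (real t + 1) powr (- 7 / 4)
      + 2 * (norm (\<xi> t \<omega>))\<^sup>2 * (real t + 1) powr (- 1 / 4)" for t \<omega>
  have y_int: "integrable M (y t)" for t
    unfolding y_def using N_int[of t] \<xi>_int[of t] by simp
  have y_nonneg: "0 \<le> y t \<omega>" for t \<omega> by (simp add: y_def)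
  have y_le: "expectation (y t) \<le> 4 * c * (real (Suc t)) powr (- 5 / 4)" for t
  proof -
    let ?r = "real t + 1"
    have "expectation (y t) = expectation (\<lambda>\<omega>. (norm (N t \<omega>))\<^sup>2) * ?r powr (- 7 / 4)
      + 2 * expectation (\<lambda>\<omega>. (norm (\<xi> t \<omega>))\<^sup>2) * ?r powr (- 1 / 4)"
      unfolding y_def using N_int[of t] \<xi>_int[of t] by simp
    also have "\<dots> \<le> (2 * c * sqrt (real t)) * ?r powr (- 7 / 4) + 2 * (c / ?r) * ?r powr (- 1 / 4)"
      using N_int[of t] \<xi>_le[of t] by (intro add_mono mult_right_mono mult_left_mono) auto
    also have "\<dots> \<le> (2 * c * ?r powr (1 / 2)) * ?r powr (- 7 / 4) + 2 * (c * ?r powr (- 1)) * ?r powr (- 1 / 4)"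
      using c by (intro add_mono mult_right_mono mult_left_mono)
        (auto simp: powr_half_sqrt powr_minus_divide)
    also have "\<dots> = 2 * c * (?r powr (1 / 2) * ?r powr (- 7 / 4)) + 2 * c * (?r powr (- 1) * ?r powr (- 1 / 4))"
      by simp
    also have "\<dots> = 4 * c * ?r powr (- 5 / 4)"
      unfolding powr_add[symmetric] by simp
    finally show ?thesis by (simp add: add.commute)
  qed
  have "summable (\<lambda>t. real t powr (- 5 / 4))" by (subst summable_real_powr_iff) simp
  then have "summable (\<lambda>t. 4 * c * real (Suc t) powr (- 5 / 4))"
    by (intro summable_mult) (subst summable_Suc_iff)
  then have "summable (\<lambda>t. expectation (y t))"
    by (rule summable_comparison_test'[where N = 0])
      (use y_le in \<open>auto simp: Bochner_Integration.integral_nonneg y_nonneg\<close>)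
  from integrable_bound_partial_sums[OF y_int y_nonneg this]
  obtain Y where Y: "integrable M Y" "\<forall>\<omega>. 0 \<le> Y \<omega>" "AE \<omega> in M. \<forall>t. (\<Sum>s<t. y s \<omega>) \<le> Y \<omega>"
    by blast
  have telescope: "(norm (N t \<omega>))\<^sup>2 / (real t + 1) \<le> (\<Sum>s<t. y s \<omega>)" for t \<omega>
  proof (induction t)
    case (Suc t)
    have "(norm (N (Suc t) \<omega>))\<^sup>2 / (real (Suc t) + 1) \<le> (norm (N t \<omega>))\<^sup>2 / (real t + 1) + y t \<omega>"
      using norm_square_walk_step[of "real t + 1" "N t \<omega>" "\<xi> t \<omega>"]
      by (simp add: NSuc y_def add.commute)
    then show ?case using Suc by simp
  qed (simp add: N0)
  show ?thesis
  proof (intro exI[of _ Y] conjI Y(1,2))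
    show "AE \<omega> in M. \<forall>t. (norm (N t \<omega>))\<^sup>2 / (real t + 1) \<le> Y \<omega>"
      using Y(3) by eventually_elim (blast intro: order_trans[OF telescope])
  qed
qed

section \<open>Independence\<close>

lemma (in prob_space) indep_var_if_indep_set:
  assumes indep: "indep_set (sets F) (sets H)" and sp: "space F = space M" "space H = space M"
    and X: "X \<in> measurable F N" and Y: "Y \<in> measurable H N'"
  shows "indep_var N X N' Y"
proof -
  have F: "sets F \<subseteq> events" and H: "sets H \<subseteq> events"
    using indep by (rule indep_setD_ev1, rule indep_setD_ev2)
  have X': "sigma_sets (space M) {X -` A \<inter> space M |A. A \<in> sets N} \<subseteq> sets F"
    using measurable_sets[OF X] sp by (auto intro!: sets.sigma_sets_subset[of _ F, simplified sp])
  have Y': "sigma_sets (space M) {Y -` A \<inter> space M |A. A \<in> sets N'} \<subseteq> sets H"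
    using measurable_sets[OF Y] sp by (auto intro!: sets.sigma_sets_subset[of _ H, simplified sp])
  have "X \<in> measurable M N"
    using measurable_mono[of N N F M] X F sp by auto
  moreover have "Y \<in> measurable M N'"
    using measurable_mono[of N' N' H M] Y H sp by auto
  moreover have "indep_set (sigma_sets (space M) {X -` A \<inter> space M |A. A \<in> sets N})
     (sigma_sets (space M) {Y -` A \<inter> space M |A. A \<in> sets N'})"
    using indep X' Y' unfolding indep_sets2_eq by blast
  ultimately show ?thesis by (simp add: indep_var_eq)
qed

lemma (in prob_space) real_cond_exp_indep:
  fixes Y :: "'a \<Rightarrow> real"
  assumes indep: "indep_set (sets F) (sets H)" and sp: "space F = space M" "space H = space M"
    and Y: "Y \<in> borel_measurable H" and int: "integrable M Y"
  shows "AE \<omega> in M. real_cond_exp M F Y \<omega> = expectation Y"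
proof -
  have "subalgebra M F"
    using indep_setD_ev1[OF indep] sp by (simp add: subalgebra_def)
  then interpret finite_measure_subalgebra M F
    by unfold_locales
  show ?thesis
  proof (rule real_cond_exp_charact)
    fix A assume A: "A \<in> sets F"
    then have AM: "A \<in> events" using indep_setD_ev1[OF indep] by auto
    have "indep_var borel (indicator A :: 'a \<Rightarrow> real) borel Y"
      using A by (intro indep_var_if_indep_set[OF indep sp _ Y]) auto
    then have "expectation (\<lambda>\<omega>. indicator A \<omega> * Y \<omega>) = expectation (indicator A) * expectation Y"
      using int AM by (intro indep_var_lebesgue_integral) (auto simp: less_top[symmetric])
    then show "(\<integral>x\<in>A. Y x \<partial>M) = (\<integral>x\<in>A. expectation Y \<partial>M)"
      using AM by (simp add: set_lebesgue_integral_def)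
  qed (use int in auto)
qed

lemma gen_events_subset: "gen_events M X I \<subseteq> Pow (space M)"
  by (auto simp: gen_events_def)

lemma gen_eventsI: "i \<in> I \<Longrightarrow> A \<in> sets borel \<Longrightarrow> X i -` A \<inter> space M \<in> gen_events M X I"
  by (auto simp: gen_events_def)

lemma measurable_sigma_gen_events:
  fixes X :: "nat \<Rightarrow> 'a \<Rightarrow> 'b::topological_space"
  assumes "i \<in> I" "gen_events M X I \<subseteq> \<A>" "\<A> \<subseteq> Pow (space M)"
  shows "X i \<in> borel_measurable (sigma (space M) \<A>)"
  using assms by (intro measurableI) (auto simp: space_measure_of sets_measure_of intro!: sigma_sets.Basic gen_eventsI)

lemma sets_sigma_gen_le:
  assumes "\<And>i. i \<in> I \<Longrightarrow> X i \<in> borel_measurable N" "space N = space M"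
  shows "gen_events M X I \<subseteq> sets N"
  using measurable_sets[OF assms(1)] by (auto simp: gen_events_def assms(2))

lemma gen_events_mono: "I \<subseteq> I' \<Longrightarrow> gen_events M X I \<subseteq> gen_events M X I'"
  by (auto simp: gen_events_def)

lemma (in prob_space) indep_set_past_future:
  assumes "indep_vars (\<lambda>_. borel) w I" "I1 \<subseteq> I" "I2 \<subseteq> I" "I1 \<inter> I2 = {}"
  shows "indep_set (sigma_sets (space M) (gen_events M w I1)) (sigma_sets (space M) (gen_events M w I2))"
proof -
  let ?E = "\<lambda>i. {w i -` A \<inter> space M |A. A \<in> sets borel}"
  let ?I = "case_bool I1 I2"
  have "indep_sets ?E I" using assms(1) unfolding indep_vars_def2 by auto
  then have 1: "indep_sets ?E (\<Union>b\<in>UNIV. ?I b)"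
    by (rule indep_sets_mono_index[rotated]) (use assms(2,3) in \<open>auto split: bool.splits\<close>)
  have "indep_sets (\<lambda>b. sigma_sets (space M) (\<Union>i\<in>?I b. ?E i)) UNIV"
  proof (rule indep_sets_collect_sigma[OF 1])
    fix b i
    show "Int_stable (?E i)"
    proof (rule Int_stableI)
      fix a b assume "a \<in> ?E i" "b \<in> ?E i"
      then obtain A B where "a = w i -` A \<inter> space M" "b = w i -` B \<inter> space M" "A \<in> sets borel" "B \<in> sets borel"
        by auto
      then show "a \<inter> b \<in> ?E i"
        by (intro CollectI exI[of _ "A \<inter> B"]) auto
    qed
    show "disjoint_family_on ?I UNIV"
      using assms(4) by (auto simp: disjoint_family_on_def split: bool.splits)
  qed
  then have "indep_sets (case_bool (sigma_sets (space M) (gen_events M w I1)) (sigma_sets (space M) (gen_events M w I2))) UNIV"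
    by (rule indep_sets_mono_sets) (auto simp: gen_events_def split: bool.splits)
  then show ?thesis by (simp add: indep_set_def)
qed

text \<open>If \<open>\<A>\<close> is independent of \<open>\<E>\<close>, and \<open>\<B>\<close>, \<open>\<D>\<close> are independent of each other inside \<open>\<E>\<close>, then
  \<open>P(a \<inter> b \<inter> d) = P(a) P(b \<inter> d) = P(a) P(b) P(d)\<close>; the sets \<open>a \<inter> b\<close> form an intersection-stable
  generator of the join of \<open>\<A>\<close> and \<open>\<B>\<close>.\<close>

lemma (in prob_space) indep_set_join:
  assumes A: "sigma_algebra (space M) \<A>" and B: "sigma_algebra (space M) \<B>" and D: "sigma_algebra (space M) \<D>"
    and BE: "\<B> \<subseteq> \<E>" and DE: "\<D> \<subseteq> \<E>" and Bint: "\<And>b d. b \<in> \<B> \<Longrightarrow> d \<in> \<D> \<Longrightarrow> b \<inter> d \<in> \<E>"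
    and ind1: "indep_set \<A> \<E>" and ind2: "indep_set \<B> \<D>"
  shows "indep_set (sigma_sets (space M) (\<A> \<union> \<B>)) \<D>"
proof -
  interpret A: sigma_algebra "space M" \<A> by (rule A)
  interpret B: sigma_algebra "space M" \<B> by (rule B)
  interpret D: sigma_algebra "space M" \<D> by (rule D)
  let ?P = "{a \<inter> b |a b. a \<in> \<A> \<and> b \<in> \<B>}"
  have ev: "\<A> \<subseteq> events" "\<B> \<subseteq> events" "\<D> \<subseteq> events"
    using indep_setD_ev1[OF ind1] indep_setD_ev1[OF ind2] indep_setD_ev2[OF ind2] by auto
  have "indep_set ?P \<D>"
  proof (rule indep_setI)
    show "?P \<subseteq> events" using ev by auto
    fix x d assume "x \<in> ?P" and d: "d \<in> \<D>"
    then obtain a b where x: "x = a \<inter> b" and a: "a \<in> \<A>" and b: "b \<in> \<B>" by auto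
    have "prob (x \<inter> d) = prob (a \<inter> (b \<inter> d))" by (simp add: x Int_assoc)
    also have "\<dots> = prob a * (prob b * prob d)"
      using indep_setD[OF ind1 a Bint[OF b d]] indep_setD[OF ind2 b d] by simp
    also have "\<dots> = prob x * prob d"
      using indep_setD[OF ind1 a] BE b by (auto simp: x)
    finally show "prob (x \<inter> d) = prob x * prob d" .
  qed (use ev in simp)
  moreover have "Int_stable ?P"
  proof (rule Int_stableI)
    fix x y assume "x \<in> ?P" "y \<in> ?P"
    then obtain a b a' b' where "x = a \<inter> b" "y = a' \<inter> b'" "a \<in> \<A>" "a' \<in> \<A>" "b \<in> \<B>" "b' \<in> \<B>" by auto
    then show "x \<inter> y \<in> ?P"
      by (intro CollectI exI[of _ "a \<inter> a'"] exI[of _ "b \<inter> b'"]) auto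
  qed
  moreover have "Int_stable \<D>" by (rule Int_stableI) auto
  ultimately have "indep_set (sigma_sets (space M) ?P) (sigma_sets (space M) \<D>)"
    by (rule indep_set_sigma_sets)
  moreover have "sigma_sets (space M) (\<A> \<union> \<B>) \<subseteq> sigma_sets (space M) ?P"
  proof (rule sigma_sets_mono)
    have "a \<in> ?P" if "a \<in> \<A>" for a
      using that A.sets_into_space by (intro CollectI exI[of _ a] exI[of _ "space M"]) auto
    moreover have "b \<in> ?P" if "b \<in> \<B>" for b
      using that B.sets_into_space by (intro CollectI exI[of _ "space M"] exI[of _ b]) auto
    ultimately show "\<A> \<union> \<B> \<subseteq> sigma_sets (space M) ?P" by (auto intro: sigma_sets.Basic)
  qed
  moreover have "sigma_sets (space M) \<D> = \<D>" by (rule D.sigma_sets_eq)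
  ultimately show ?thesis unfolding indep_sets2_eq by blast
qed

lemma sets_generated_by: "sets (generated_by M X I) = sigma_sets (space M) (gen_events M X I)"
  unfolding generated_by_def by (simp add: sets_measure_of gen_events_subset)

lemma sigma_algebra_gen_events:
  "sigma_algebra (space M) (sigma_sets (space M) (gen_events M X I))"
  by (intro sigma_algebra_sigma_sets gen_events_subset)

text \<open>The observation filtration at time \<open>t\<close> does not contain the operator \<open>S\<^sub>t\<^sub>+\<^sub>1\<close>, but the gain \<open>K\<^sub>t\<close> depends
  on it. So the noise at time \<open>t + 1\<close> has to be independent of the larger \<open>\<sigma>\<close>-algebra of all operators
  and the noise up to time \<open>t\<close>.\<close>

lemma observation_model_indep:
  assumes model: "observation_model M S w zs \<Gamma> Amax"
  shows "prob_space.indep_set M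
    (sets (sigma (space M) (gen_events M S {1..} \<union> gen_events M w {1..t})))
    (sets (generated_by M w {Suc t}))"
proof -
  interpret prob_space M using model by (simp add: observation_model_def)
  have iv: "indep_vars (\<lambda>_. borel) w {1..}"
    and SW: "indep_set (sets (generated_by M S {1..})) (sets (generated_by M w {1..}))"
    using model by (auto simp: observation_model_def)
  let ?\<sigma> = "\<lambda>G. sigma_sets (space M) G"
  note alg = sigma_algebra_gen_events[of M]
  have le: "?\<sigma> (gen_events M w I) \<subseteq> ?\<sigma> (gen_events M w {1..})" if "I \<subseteq> {1..}" for I
    using that by (intro sigma_sets_mono' gen_events_mono)
  have "indep_set (?\<sigma> (?\<sigma> (gen_events M S {1..}) \<union> ?\<sigma> (gen_events M w {1..t})))
      (?\<sigma> (gen_events M w {Suc t}))"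
  proof (rule indep_set_join[OF alg alg alg le le])
    interpret W: sigma_algebra "space M" "?\<sigma> (gen_events M w {1..})" by (rule alg)
    show "b \<inter> d \<in> ?\<sigma> (gen_events M w {1..})"
      if "b \<in> ?\<sigma> (gen_events M w {1..t})" "d \<in> ?\<sigma> (gen_events M w {Suc t})" for b d
      by (intro W.Int subsetD[OF le that(1)] subsetD[OF le that(2)]) auto
    show "indep_set (?\<sigma> (gen_events M S {1..})) (?\<sigma> (gen_events M w {1..}))"
      using SW unfolding sets_generated_by .
    show "indep_set (?\<sigma> (gen_events M w {1..t})) (?\<sigma> (gen_events M w {Suc t}))"
      by (rule indep_set_past_future[OF iv]) auto
  qed auto
  moreover have "sets (sigma (space M) (gen_events M S {1..} \<union> gen_events M w {1..t}))
      \<subseteq> ?\<sigma> (?\<sigma> (gen_events M S {1..}) \<union> ?\<sigma> (gen_events M w {1..t}))"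
    by (subst sets_measure_of)
      (auto simp: gen_events_subset intro!: sigma_sets_mono' dest: subsetD[OF gen_events_subset]
        intro: sigma_sets.Basic)
  ultimately show ?thesis unfolding sets_generated_by indep_sets2_eq by blast
qed

text \<open>Turns the step-size condition, which contains the inverse of the spread, into a bound on
  \<open>h E\<^sub>0\<close>.\<close>

lemma spread_pos_if_loewner:
  assumes "ens_cov J z \<succ>\<^sub>L \<sigma> *\<^sub>R mat 1" "0 < \<sigma>"
  shows "0 < ens_spread J (z :: nat \<Rightarrow> real^'d)"
proof -
  define x :: "real^'d" where "x = axis undefined 1"
  have n: "norm x = 1" by (simp add: x_def norm_axis_1)
  then have "x \<noteq> 0" by auto
  then have "0 < x \<bullet> ((ens_cov J z - \<sigma> *\<^sub>R mat 1) *v x)"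
    using assms(1) by (auto simp: loewner_greater_def pos_def_matrix_def)
  then have "\<sigma> * (x \<bullet> x) < x \<bullet> (ens_cov J z *v x)"
    by (simp add: matrix_vector_mult_diff_rdistrib inner_diff_right inner_scaleR_mat)
  also have "\<dots> \<le> ens_spread J z" using inner_ens_cov_le[of x J z x] n by simp
  finally show ?thesis using \<open>0 < \<sigma>\<close> n by (simp add: power2_norm_eq_inner[symmetric])
qed

section \<open>The random ensemble\<close>

locale deki_process =
  fixes M :: "'a measure"
    and S :: "nat \<Rightarrow> 'a \<Rightarrow> real^'d^'p" and w :: "nat \<Rightarrow> 'a \<Rightarrow> real^'p" and zs :: "real^'d"
    and \<Gamma> :: "real^'p^'p" and z :: "nat \<Rightarrow> nat \<Rightarrow> 'a \<Rightarrow> real^'d"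
    and J :: nat and a \<alpha> h \<sigma> :: real
  assumes model: "observation_model M S w zs \<Gamma> a"
    and J: "J \<ge> 1" and \<alpha>: "\<alpha> > 0" and h: "h > 0"
    and dyn: "deki M J \<alpha> (\<lambda>_. h) S (obs S w zs) z"
    and \<sigma>: "\<sigma> > 0"
    and init: "AE \<omega> in M. ens_cov J (\<lambda>j. z 0 j \<omega>) \<succ>\<^sub>L \<sigma> *\<^sub>R mat 1"
    and step: "AE \<omega> in M. h \<le> min (\<alpha> / (real J * (a + \<alpha>)\<^sup>2)) (real J / \<alpha>)
                                  * inverse (ens_spread J (\<lambda>j. z 0 j \<omega>))"
begin

sublocale prob_space M
  using model by (simp add: observation_model_def)

abbreviation "u \<equiv> obs S w zs"
abbreviation "F \<equiv> obs_filtration M S u"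

text \<open>All operators are included, also the future ones, because the gain \<open>K\<^sub>t\<close> involves \<open>S\<^sub>t\<^sub>+\<^sub>1\<close>.\<close>

definition past :: "nat \<Rightarrow> 'a measure" where
  "past t = sigma (space M) (gen_events M S {1..} \<union> gen_events M w {1..t})"

lemma a_pos: "0 < a" and \<Gamma>: "pos_def_matrix \<Gamma>"
  and S_meas: "1 \<le> t \<Longrightarrow> S t \<in> borel_measurable M"
  and w_dist: "1 \<le> t \<Longrightarrow> distributed M lborel (w t) (\<lambda>x. ennreal (gaussian_density \<Gamma> x))"
  and forward_bound: "1 \<le> t \<Longrightarrow> AE \<omega> in M. op_norm (transpose (S t \<omega>) ** S t \<omega>) \<le> a"
  and F_indep: "indep_set (sets (F t)) (sets (generated_by M w {t<..}))"
  using model by (auto simp: observation_model_def)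

lemma w_meas: "1 \<le> t \<Longrightarrow> w t \<in> borel_measurable M"
  using distributed_measurable[OF w_dist] by simp

lemma u_meas:
  assumes "S t \<in> borel_measurable N" "w t \<in> borel_measurable N"
  shows "u t \<in> borel_measurable N"
  unfolding obs_def[abs_def] using assms by measurable

lemma space_F: "space (F t) = space M"
  by (simp add: obs_filtration_def space_measure_of gen_events_subset)

lemma space_past: "space (past t) = space M"
  by (simp add: past_def space_measure_of gen_events_subset)

lemma space_generated_by: "space (generated_by M w I) = space M"
  by (simp add: generated_by_def space_measure_of gen_events_subset)

lemma sets_F: "sets (F t) = sigma_sets (space M) (gen_events M S {1..t} \<union> gen_events M u {1..t})"
  by (simp add: obs_filtration_def sets_measure_of gen_events_subset)

lemma subalgebra_F:
  assumes "space N = space M"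
    and "\<And>s. s \<in> {1..t} \<Longrightarrow> S s \<in> borel_measurable N" "\<And>s. s \<in> {1..t} \<Longrightarrow> w s \<in> borel_measurable N"
  shows "subalgebra N (F t)"
proof -
  have "gen_events M S {1..t} \<union> gen_events M u {1..t} \<subseteq> sets N"
    by (intro Un_least sets_sigma_gen_le u_meas assms)
  then show ?thesis
    unfolding subalgebra_def sets_F space_F assms(1)[symmetric] 
    using sets.sigma_sets_subset by blast
qed

lemma past_indep: "indep_set (sets (past t)) (sets (generated_by M w {Suc t}))"
  unfolding past_def by (rule observation_model_indep[OF model])

lemma past_le: "subalgebra M (past t)"
  using indep_setD_ev1[OF past_indep] by (simp add: subalgebra_def space_past)

lemma S_past: "1 \<le> s \<Longrightarrow> S s \<in> borel_measurable (past t)"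
  unfolding past_def by (rule measurable_sigma_gen_events[of _ "{1..}"]) (simp_all add: gen_events_subset)

lemma w_past: "1 \<le> s \<Longrightarrow> s \<le> t \<Longrightarrow> w s \<in> borel_measurable (past t)"
  unfolding past_def by (rule measurable_sigma_gen_events[of _ "{1..t}"]) (simp_all add: gen_events_subset)

lemma w_generated: "s \<in> I \<Longrightarrow> w s \<in> borel_measurable (generated_by M w I)"
  unfolding generated_by_def by (rule measurable_sigma_gen_events[of _ I]) (simp_all add: gen_events_subset)

lemma z_adapted: "j \<in> {1..J} \<Longrightarrow> z t j \<in> borel_measurable (F t)"
  using dyn by (simp add: deki_def)

lemma z_past: "s \<le> t \<Longrightarrow> j \<in> {1..J} \<Longrightarrow> z s j \<in> borel_measurable (past t)"
  by (rule measurable_from_subalg[OF subalgebra_F z_adapted]) (auto simp: space_past intro: S_past w_past)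

lemma subalgebra_M_F: "subalgebra M (F t)"
  by (rule subalgebra_F) (auto intro: S_meas w_meas)

text \<open>The ensemble at time \<open>0\<close> is measurable with respect to the trivial \<open>\<sigma>\<close>-algebra, so the preimage of
  a value that it takes is the whole space.\<close>

lemma init_deterministic:
  assumes "\<omega> \<in> space M" "\<omega>' \<in> space M" "j \<in> {1..J}"
  shows "z 0 j \<omega> = z 0 j \<omega>'"
proof -
  have "z 0 j -` {z 0 j \<omega>'} \<inter> space (F 0) \<in> sets (F 0)"
    by (rule measurable_sets[OF z_adapted]) (use assms in auto)
  then have "z 0 j -` {z 0 j \<omega>'} \<inter> space M \<in> {{}, space M}"
    by (simp add: space_F sets_F gen_events_def sigma_sets_empty_eq)
  then show ?thesis using assms by auto
qed

definition spread0 :: real where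
  "spread0 = ens_spread J (\<lambda>j. z 0 j (SOME \<omega>. \<omega> \<in> space M))"

definition mean0 :: "real^'d" where
  "mean0 = ens_mean J (\<lambda>j. z 0 j (SOME \<omega>. \<omega> \<in> space M))"

lemma some_point: "(SOME \<omega>. \<omega> \<in> space M) \<in> space M"
  using not_empty by (simp add: some_in_eq)

lemma spread0: "\<omega> \<in> space M \<Longrightarrow> ens_spread J (\<lambda>j. z 0 j \<omega>) = spread0"
  unfolding spread0_def by (intro ens_spread_cong init_deterministic some_point)

lemma mean0: "\<omega> \<in> space M \<Longrightarrow> mean_path J z 0 \<omega> = mean0"
  unfolding mean0_def by (intro ens_mean_cong init_deterministic some_point)

text \<open>The smallest constant to which \<open>deki_path\<close> applies.\<close>

definition decay_const :: real where
  "decay_const = max spread0 (real CARD('d) / (h * \<alpha>))"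

definition gain_const :: real where
  "gain_const = deki_path.gain_bound \<alpha> h \<sigma> a decay_const"

abbreviation regular_path :: "'a \<Rightarrow> bool" where
  "regular_path \<omega> \<equiv> deki_path J \<alpha> h \<sigma> a decay_const (\<lambda>t. S t \<omega>) (\<lambda>t. u t \<omega>) (\<lambda>t j. z t j \<omega>)"

text \<open>Off a null set, the almost sure hypotheses hold for all times simultaneously.\<close>

lemma AE_path: "AE \<omega> in M. regular_path \<omega>"
proof -
  have "AE \<omega> in M. \<forall>t. 1 \<le> t \<longrightarrow> op_norm (transpose (S t \<omega>) ** S t \<omega>) \<le> a"
    unfolding AE_all_countable using forward_bound by auto
  with init step AE_space show ?thesis
  proof eventually_elim
    case (elim \<omega>)
    have E: "ens_spread J (\<lambda>j. z 0 j \<omega>) = spread0" using elim by (intro spread0)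
    have E0: "0 < spread0"
      using spread_pos_if_loewner[OF elim(1) \<sigma>] E by simp
    have "h * spread0 \<le> min (\<alpha> / (real J * (a + \<alpha>)\<^sup>2)) (real J / \<alpha>)"
      using elim(2) E0 unfolding E by (simp add: field_simps)
    also have "\<dots> \<le> \<alpha> / (1 * (a + \<alpha>)\<^sup>2)"
      using J \<alpha> a_pos by (intro min.coboundedI1 divide_left_mono mult_right_mono) auto
    finally have small: "h * spread0 * (a + \<alpha>)\<^sup>2 \<le> \<alpha>"
      using a_pos \<alpha> by (simp add: pos_le_divide_eq)
    have dim: "real CARD('d) \<le> h * \<alpha> * decay_const"
    proof -
      have "real CARD('d) / (h * \<alpha>) \<le> decay_const" by (simp add: decay_const_def)
      then show ?thesis using h \<alpha> by (simp add: pos_divide_le_eq mult.commute)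
    qed
    have rec: "deki_recursion J \<alpha> (\<lambda>_. h) (\<lambda>t. S t \<omega>) (\<lambda>t. u t \<omega>) (\<lambda>t j. z t j \<omega>)"
      using dyn elim by (simp add: deki_def)
    show ?case
      by unfold_locales (use elim J \<alpha> h \<sigma> a_pos small dim rec in \<open>auto simp: E decay_const_def\<close>)
  qed
qed

definition random_gain :: "nat \<Rightarrow> 'a \<Rightarrow> real^'p^'d" where
  "random_gain t \<omega> = gain J \<alpha> h (\<lambda>t. S t \<omega>) (\<lambda>t j. z t j \<omega>) t"

definition noise_response :: "nat \<Rightarrow> 'a \<Rightarrow> real^'d" where
  "noise_response t \<omega> = response J \<alpha> h (\<lambda>t. S t \<omega>) (\<lambda>t j. z t j \<omega>) (\<lambda>t. w t \<omega>) t"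

lemma random_gain_past: "random_gain t \<in> borel_measurable (past t)"
  unfolding random_gain_def[abs_def]
  by (rule borel_measurable_gain) (auto intro: z_past S_past)

lemma noise_response_past: "noise_response t \<in> borel_measurable (past t)"
  unfolding noise_response_def[abs_def]
  by (rule borel_measurable_response) (auto intro: z_past S_past w_past)

lemma random_gain_meas [measurable]: "random_gain t \<in> borel_measurable M"
  by (rule measurable_from_subalg[OF past_le random_gain_past])

lemma noise_response_meas [measurable]: "noise_response t \<in> borel_measurable M"
  by (rule measurable_from_subalg[OF past_le noise_response_past])

lemma w_Suc_meas [measurable]: "w (Suc t) \<in> borel_measurable M"
  by (rule w_meas) simp

lemma AE_norm_random_gain_le: "AE \<omega> in M. \<forall>t x. norm (random_gain t \<omega> *v x) \<le> gain_const / sqrt (real t + 1) * norm x"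
  using AE_path
proof eventually_elim
  case (elim \<omega>)
  show ?case using deki_path.norm_gain_le[OF elim] by (simp add: random_gain_def gain_const_def)
qed

definition noise_var :: real where
  "noise_var = (\<integral>x. (norm x)\<^sup>2 \<partial>gaussian \<Gamma>)"

lemma w_second_moment:
  "integrable M (\<lambda>\<omega>. (norm (w (Suc t) \<omega>))\<^sup>2)"
  "expectation (\<lambda>\<omega>. (norm (w (Suc t) \<omega>))\<^sup>2) = noise_var"
  using gaussian_random_vector(1,2)[OF w_dist \<Gamma>, of "Suc t"] by (simp_all add: noise_var_def)

lemma integrable_norm_if_square:
  fixes X :: "'a \<Rightarrow> 'v::euclidean_space"
  assumes [measurable]: "X \<in> borel_measurable M" and "integrable M (\<lambda>\<omega>. (norm (X \<omega>))\<^sup>2)"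
  shows "integrable M (\<lambda>\<omega>. norm (X \<omega>))"
proof (rule Bochner_Integration.integrable_bound)
  show "integrable M (\<lambda>\<omega>. 1 + (norm (X \<omega>))\<^sup>2)" using assms by simp
  have "norm (X \<omega>) \<le> 1 + (norm (X \<omega>))\<^sup>2" for \<omega>
  proof -
    have "2 * norm (X \<omega>) \<le> 1 + (norm (X \<omega>))\<^sup>2"
      using zero_le_power2[of "norm (X \<omega>) - 1"] by (simp add: power2_diff)
    then show ?thesis using norm_ge_zero[of "X \<omega>"] by linarith
  qed
  then show "AE \<omega> in M. norm (norm (X \<omega>)) \<le> norm (1 + (norm (X \<omega>))\<^sup>2)" by simp
qed simp

text \<open>Moving the gain to the other side, \<open>N\<^sub>t \<bullet> K\<^sub>t w\<^sub>t\<^sub>+\<^sub>1 = X \<bullet> w\<^sub>t\<^sub>+\<^sub>1\<close> with \<open>X = K\<^sub>t\<^sup>T N\<^sub>t\<close> determined by the past, so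
  each coordinate contributes \<open>E X\<^sub>i E w\<^sub>i = 0\<close>. Boundedness of the gain and square integrability of
  \<open>N\<^sub>t\<close> make the factors integrable.\<close>

lemma noise_orthogonal:
  assumes N: "integrable M (\<lambda>\<omega>. (norm (noise_response t \<omega>))\<^sup>2)"
  shows "expectation (\<lambda>\<omega>. noise_response t \<omega> \<bullet> (random_gain t \<omega> *v w (Suc t) \<omega>)) = 0"
proof -
  define X where "X \<omega> = transpose (random_gain t \<omega>) *v noise_response t \<omega>" for \<omega>
  have X_past: "X \<in> borel_measurable (past t)"
    unfolding X_def[abs_def]
    by (intro borel_measurable_matrix_vector_mult borel_measurable_transpose random_gain_past noise_response_past)
  have [measurable]: "X \<in> borel_measurable M"
    by (rule measurable_from_subalg[OF past_le X_past])
  have prod: "expectation (\<lambda>\<omega>. X \<omega> $ i * w (Suc t) \<omega> $ i) = 0 \<and>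
      integrable M (\<lambda>\<omega>. X \<omega> $ i * w (Suc t) \<omega> $ i)" for i
  proof -
    have "(\<lambda>\<omega>. X \<omega> $ i) \<in> borel_measurable (past t)"
      using X_past by measurable
    moreover have "(\<lambda>\<omega>. w (Suc t) \<omega> $ i) \<in> borel_measurable (generated_by M w {Suc t})"
      by (intro borel_measurable_vec_nth w_generated) simp
    ultimately have ind: "indep_var borel (\<lambda>\<omega>. X \<omega> $ i) borel (\<lambda>\<omega>. w (Suc t) \<omega> $ i)"
      by (rule indep_var_if_indep_set[OF past_indep space_past space_generated_by])
    have X_int: "integrable M (\<lambda>\<omega>. X \<omega> $ i)"
    proof (rule Bochner_Integration.integrable_bound)
      show "integrable M (\<lambda>\<omega>. gain_const / sqrt (real t + 1) * norm (noise_response t \<omega>))"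
        using integrable_norm_if_square[OF noise_response_meas N] by simp
      show "AE \<omega> in M. norm (X \<omega> $ i) \<le> norm (gain_const / sqrt (real t + 1) * norm (noise_response t \<omega>))"
        using AE_norm_random_gain_le
      proof eventually_elim
        case (elim \<omega>)
        have "norm (X \<omega> $ i) \<le> norm (X \<omega>)"
          by (simp add: component_le_norm_cart)
        also have "\<dots> \<le> gain_const / sqrt (real t + 1) * norm (noise_response t \<omega>)"
          unfolding X_def using elim by (intro norm_transpose_mult_le) auto
        finally show ?case by (rule order_trans) (simp only: real_norm_def abs_ge_self)
      qed
    qed measurable
    have w_int: "integrable M (\<lambda>\<omega>. w (Suc t) \<omega> $ i)"
    proof (rule Bochner_Integration.integrable_bound)
      show "integrable M (\<lambda>\<omega>. norm (w (Suc t) \<omega>))"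
        by (rule integrable_norm_if_square[OF w_Suc_meas w_second_moment(1)])
    qed (auto simp: norm_nth_le intro!: AE_I2 component_le_norm_cart)
    show ?thesis
      using indep_var_lebesgue_integral[OF ind X_int w_int] indep_var_integrable[OF ind X_int w_int]
        gaussian_random_vector(3)[OF w_dist \<Gamma>, of "Suc t" i] by simp
  qed
  have "noise_response t \<omega> \<bullet> (random_gain t \<omega> *v w (Suc t) \<omega>) = (\<Sum>i\<in>UNIV. X \<omega> $ i * w (Suc t) \<omega> $ i)" for \<omega>
    by (simp only: inner_matrix_vector_adjoint X_def[symmetric]) (simp add: inner_vec_def)
  then show ?thesis using prod by simp
qed

lemma noise_response_dominated:
  "\<exists>Y. integrable M Y \<and> (\<forall>\<omega>. 0 \<le> Y \<omega>) \<and> (AE \<omega> in M. \<forall>t. (norm (noise_response t \<omega>))\<^sup>2 / (real t + 1) \<le> Y \<omega>)"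
proof (rule normalized_walk_dominated)
  let ?\<xi> = "\<lambda>t \<omega>. random_gain t \<omega> *v w (Suc t) \<omega>"
  show "noise_response 0 \<omega> = 0" "noise_response (Suc t) \<omega> = noise_response t \<omega> + ?\<xi> t \<omega>" for t \<omega>
    by (simp_all add: noise_response_def random_gain_def)
  show [measurable]: "?\<xi> t \<in> borel_measurable M" for t by measurable
  have bound: "AE \<omega> in M. (norm (?\<xi> t \<omega>))\<^sup>2 \<le> gain_const\<^sup>2 / (real t + 1) * (norm (w (Suc t) \<omega>))\<^sup>2" for t
    using AE_norm_random_gain_le
  proof eventually_elim
    case (elim \<omega>)
    then have "(norm (?\<xi> t \<omega>))\<^sup>2 \<le> (gain_const / sqrt (real t + 1) * norm (w (Suc t) \<omega>))\<^sup>2"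
      by (intro power_mono) auto
    then show ?case by (simp add: power_mult_distrib power_divide)
  qed
  show int: "integrable M (\<lambda>\<omega>. (norm (?\<xi> t \<omega>))\<^sup>2)" for t
  proof (rule Bochner_Integration.integrable_bound)
    show "integrable M (\<lambda>\<omega>. gain_const\<^sup>2 / (real t + 1) * (norm (w (Suc t) \<omega>))\<^sup>2)"
      using w_second_moment by simp
    show "AE \<omega> in M. norm ((norm (?\<xi> t \<omega>))\<^sup>2) \<le> norm (gain_const\<^sup>2 / (real t + 1) * (norm (w (Suc t) \<omega>))\<^sup>2)"
      using bound[of t] by eventually_elim simp
  qed measurable
  have "expectation (\<lambda>\<omega>. (norm (?\<xi> t \<omega>))\<^sup>2)
      \<le> expectation (\<lambda>\<omega>. gain_const\<^sup>2 / (real t + 1) * (norm (w (Suc t) \<omega>))\<^sup>2)" for t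
    using w_second_moment by (intro integral_mono_AE int bound) simp
  then show "expectation (\<lambda>\<omega>. (norm (?\<xi> t \<omega>))\<^sup>2) \<le> gain_const\<^sup>2 * noise_var / (real t + 1)" for t
    by (simp add: w_second_moment(2))
qed (rule noise_orthogonal)

text \<open>By \<open>norm_mean_le\<close> the mean is bounded by a constant, coming from the deterministic initial mean and
  the signal, plus a multiple of \<open>|N\<^sub>t| / \<surd>(t + 1)\<close>, which is dominated uniformly in \<open>t\<close>. Both claims
  of the theorem are read off from the variable \<open>Y\<close>.\<close>

lemma mean_dominated:
  "\<exists>Y. integrable M Y \<and> (\<forall>\<omega>. 0 \<le> Y \<omega>) \<and> (AE \<omega> in M. \<forall>t. (norm (mean_path J z t \<omega>))\<^sup>2 \<le> Y \<omega>)"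
proof -
  obtain Y where Y: "integrable M Y" "\<forall>\<omega>. 0 \<le> Y \<omega>"
      "AE \<omega> in M. \<forall>t. (norm (noise_response t \<omega>))\<^sup>2 / (real t + 1) \<le> Y \<omega>"
    using noise_response_dominated by blast
  define k where "k = norm mean0 + 2 * (gain_const * sqrt a * norm zs)"
  define c where "c = 2 * \<bar>decay_const / \<sigma>\<bar>"
  have sq2: "(p + q)\<^sup>2 \<le> 2 * (p\<^sup>2 + q\<^sup>2)" for p q :: real
    using zero_le_power2[of "p - q"] by (simp add: power2_diff power2_sum)
  have "AE \<omega> in M. \<forall>t. (norm (mean_path J z t \<omega>))\<^sup>2 \<le> c * (k\<^sup>2 + Y \<omega>)"
    using AE_path Y(3) AE_space
  proof (eventually_elim, intro allI)
    fix \<omega> t assume p: "regular_path \<omega>" and N: "\<forall>t. (norm (noise_response t \<omega>))\<^sup>2 / (real t + 1) \<le> Y \<omega>" and \<omega>: "\<omega> \<in> space M"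
    interpret deki_path J \<alpha> h \<sigma> a decay_const "\<lambda>t. S t \<omega>" "\<lambda>t. u t \<omega>" "\<lambda>t j. z t j \<omega>" by (rule p)
    let ?n = "norm (noise_response t \<omega>) / sqrt (real t + 1)"
    have "norm (mean_path J z t \<omega>) \<le> sqrt (decay_const / \<sigma>) * (k + ?n)"
      using norm_mean_le[of zs "\<lambda>t. w t \<omega>" t] \<omega>
      by (simp add: obs_def k_def gain_const_def noise_response_def mean0)
    then have "(norm (mean_path J z t \<omega>))\<^sup>2 \<le> (sqrt (decay_const / \<sigma>) * (k + ?n))\<^sup>2"
      by (intro power_mono) auto
    also have "\<dots> = decay_const / \<sigma> * (k + ?n)\<^sup>2"
      using \<kappa>_pos \<sigma> by (simp add: power_mult_distrib)
    also have "\<dots> \<le> decay_const / \<sigma> * (2 * (k\<^sup>2 + ?n\<^sup>2))"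
      using \<kappa>_pos \<sigma> by (intro mult_left_mono sq2) simp
    also have "\<dots> = c * (k\<^sup>2 + (norm (noise_response t \<omega>))\<^sup>2 / (real t + 1))"
      using \<kappa>_pos \<sigma> by (simp add: c_def power_divide)
    also have "\<dots> \<le> c * (k\<^sup>2 + Y \<omega>)"
      using N by (intro mult_left_mono add_left_mono) (auto simp: c_def)
    finally show "(norm (mean_path J z t \<omega>))\<^sup>2 \<le> c * (k\<^sup>2 + Y \<omega>)" .
  qed
  then show ?thesis
    using Y by (intro exI[of _ "\<lambda>\<omega>. c * (k\<^sup>2 + Y \<omega>)"]) (auto simp: c_def)
qed

lemma mean_adapted: "mean_path J z t \<in> borel_measurable (F t)"
  by (rule borel_measurable_ens_mean) (rule z_adapted)

lemma mean_meas [measurable]: "mean_path J z t \<in> borel_measurable M"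
  by (rule measurable_from_subalg[OF subalgebra_M_F mean_adapted])

definition increment_const :: real where
  "increment_const = 3 * (h * decay_const)\<^sup>2 * ((a + \<alpha>)\<^sup>2 + a\<^sup>2 * (norm zs)\<^sup>2 + a)"

lemma increment_const_pos: "0 < increment_const"
proof -
  have "0 < decay_const" using h \<alpha> by (simp add: decay_const_def less_max_iff_disj)
  then show ?thesis
    using h a_pos by (simp add: increment_const_def add_nonneg_pos)
qed

lemma AE_increment_le:
  "AE \<omega> in M. (norm (mean_path J z (Suc t) \<omega> - mean_path J z t \<omega>))\<^sup>2
     \<le> increment_const / (real t + 1)\<^sup>2 * ((norm (mean_path J z t \<omega>))\<^sup>2 + 1 + (norm (w (Suc t) \<omega>))\<^sup>2)"
  using AE_path
proof eventually_elim
  case (elim \<omega>)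
  then interpret deki_path J \<alpha> h \<sigma> a decay_const "\<lambda>t. S t \<omega>" "\<lambda>t. u t \<omega>" "\<lambda>t j. z t j \<omega>" .
  define A B D where "A = norm (mean_path J z t \<omega>)" and "B = norm zs" and "D = norm (w (Suc t) \<omega>)"
  have sq3: "(p + q + r)\<^sup>2 \<le> 3 * (p\<^sup>2 + q\<^sup>2 + r\<^sup>2)" for p q r :: real
  proof -
    have "0 \<le> (p - q)\<^sup>2 + (q - r)\<^sup>2 + (p - r)\<^sup>2" by simp
    then show ?thesis by (simp add: power2_eq_square algebra_simps)
  qed
  have "norm (mean_path J z (Suc t) \<omega> - mean_path J z t \<omega>)
      \<le> h * decay_const / (real t + 1) * ((a + \<alpha>) * A + a * B + sqrt a * D)"
    using norm_mean_increment_le[of zs "\<lambda>t. w t \<omega>" t] by (simp add: obs_def A_def B_def D_def)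
  then have "(norm (mean_path J z (Suc t) \<omega> - mean_path J z t \<omega>))\<^sup>2
      \<le> (h * decay_const / (real t + 1) * ((a + \<alpha>) * A + a * B + sqrt a * D))\<^sup>2"
    by (intro power_mono) auto
  also have "\<dots> = (h * decay_const)\<^sup>2 / (real t + 1)\<^sup>2 * ((a + \<alpha>) * A + a * B + sqrt a * D)\<^sup>2"
    by (simp add: power_mult_distrib power_divide)
  also have "\<dots> \<le> (h * decay_const)\<^sup>2 / (real t + 1)\<^sup>2 * (3 * (((a + \<alpha>) * A)\<^sup>2 + (a * B)\<^sup>2 + (sqrt a * D)\<^sup>2))"
    by (intro mult_left_mono sq3) auto
  also have "\<dots> \<le> (h * decay_const)\<^sup>2 / (real t + 1)\<^sup>2 * (3 * (((a + \<alpha>)\<^sup>2 + a\<^sup>2 * B\<^sup>2 + a) * (A\<^sup>2 + 1 + D\<^sup>2)))"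
  proof (intro mult_left_mono)
    define T where "T = A\<^sup>2 + 1 + D\<^sup>2"
    have T: "A\<^sup>2 \<le> T" "1 \<le> T" "D\<^sup>2 \<le> T" by (simp_all add: T_def)
    have "((a + \<alpha>) * A)\<^sup>2 + (a * B)\<^sup>2 + (sqrt a * D)\<^sup>2 = (a + \<alpha>)\<^sup>2 * A\<^sup>2 + a\<^sup>2 * B\<^sup>2 * 1 + a * D\<^sup>2"
      using a by (simp add: power_mult_distrib)
    also have "\<dots> \<le> (a + \<alpha>)\<^sup>2 * T + a\<^sup>2 * B\<^sup>2 * T + a * T"
      using a T by (intro add_mono mult_left_mono) auto
    also have "\<dots> = ((a + \<alpha>)\<^sup>2 + a\<^sup>2 * B\<^sup>2 + a) * T"
      by (simp add: distrib_right)
    finally show "((a + \<alpha>) * A)\<^sup>2 + (a * B)\<^sup>2 + (sqrt a * D)\<^sup>2 \<le> ((a + \<alpha>)\<^sup>2 + a\<^sup>2 * B\<^sup>2 + a) * (A\<^sup>2 + 1 + D\<^sup>2)"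
      unfolding T_def .
  qed auto
  also have "\<dots> = increment_const / (real t + 1)\<^sup>2 * (A\<^sup>2 + 1 + D\<^sup>2)"
    by (simp add: increment_const_def B_def mult_ac)
  finally show ?case by (simp add: A_def D_def)
qed

lemma mean_square_integrable: "integrable M (\<lambda>\<omega>. (norm (mean_path J z t \<omega>))\<^sup>2)"
proof -
  obtain Y where Y: "integrable M Y" "AE \<omega> in M. \<forall>t. (norm (mean_path J z t \<omega>))\<^sup>2 \<le> Y \<omega>"
    using mean_dominated by blast
  show ?thesis
  proof (rule Bochner_Integration.integrable_bound[OF Y(1)])
    show "AE \<omega> in M. norm ((norm (mean_path J z t \<omega>))\<^sup>2) \<le> norm (Y \<omega>)"
      using Y(2) by eventually_elim (auto intro: order_trans[OF _ abs_ge_self])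
  qed measurable
qed

lemma increment_integrable:
  "integrable M (\<lambda>\<omega>. (norm (mean_path J z (Suc t) \<omega> - mean_path J z t \<omega>))\<^sup>2)"
proof (rule Bochner_Integration.integrable_bound)
  show "integrable M (\<lambda>\<omega>. increment_const / (real t + 1)\<^sup>2 *
      ((norm (mean_path J z t \<omega>))\<^sup>2 + 1 + (norm (w (Suc t) \<omega>))\<^sup>2))"
    using mean_square_integrable w_second_moment(1) by simp
  show "AE \<omega> in M. norm ((norm (mean_path J z (Suc t) \<omega> - mean_path J z t \<omega>))\<^sup>2)
     \<le> norm (increment_const / (real t + 1)\<^sup>2 * ((norm (mean_path J z t \<omega>))\<^sup>2 + 1 + (norm (w (Suc t) \<omega>))\<^sup>2))"
    using AE_increment_le[of t]
  proof eventually_elim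
    case (elim \<omega>)
    then show ?case unfolding real_norm_def abs_power2 by (rule order_trans) (rule abs_ge_self)
  qed
qed measurable

text \<open>The mean at time \<open>t\<close> is known at time \<open>t\<close>, and the next noise is independent of the observations up
  to time \<open>t\<close>; so conditioning keeps the former and averages the latter.\<close>

lemma AE_cond_exp_increment_le:
  "AE \<omega> in M. real_cond_exp M (F t) (\<lambda>\<omega>. (norm (mean_path J z (Suc t) \<omega> - mean_path J z t \<omega>))\<^sup>2) \<omega>
     \<le> increment_const / (real t + 1)\<^sup>2 * ((norm (mean_path J z t \<omega>))\<^sup>2 + 1 + noise_var)"
proof -
  interpret finite_measure_subalgebra M "F t"
    by unfold_locales (rule subalgebra_M_F)
  let ?c = "increment_const / (real t + 1)\<^sup>2"
  let ?Z = "\<lambda>\<omega>. (norm (mean_path J z t \<omega>))\<^sup>2 + 1"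
  let ?W = "\<lambda>\<omega>. (norm (w (Suc t) \<omega>))\<^sup>2"
  have Z: "integrable M ?Z" using mean_square_integrable by simp
  note W = w_second_moment[of t]
  have Z_F: "?Z \<in> borel_measurable (F t)"
    using mean_adapted[of t] by measurable
  have W_gen: "?W \<in> borel_measurable (generated_by M w {t<..})"
    using w_generated[of "Suc t" "{t<..}"] by measurable
  have "AE \<omega> in M. real_cond_exp M (F t) (\<lambda>\<omega>. (norm (mean_path J z (Suc t) \<omega> - mean_path J z t \<omega>))\<^sup>2) \<omega>
     \<le> real_cond_exp M (F t) (\<lambda>\<omega>. ?c * (?Z \<omega> + ?W \<omega>)) \<omega>"
    using AE_increment_le Z W by (intro real_cond_exp_mono increment_integrable) auto
  moreover have "AE \<omega> in M. real_cond_exp M (F t) (\<lambda>\<omega>. ?c * (?Z \<omega> + ?W \<omega>)) \<omega>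
      = ?c * real_cond_exp M (F t) (\<lambda>\<omega>. ?Z \<omega> + ?W \<omega>) \<omega>"
    using Z W by (intro real_cond_exp_cmult) auto
  moreover have "AE \<omega> in M. real_cond_exp M (F t) (\<lambda>\<omega>. ?Z \<omega> + ?W \<omega>) \<omega>
      = real_cond_exp M (F t) ?Z \<omega> + real_cond_exp M (F t) ?W \<omega>"
    by (rule real_cond_exp_add[OF Z W(1)])
  moreover have "AE \<omega> in M. real_cond_exp M (F t) ?Z \<omega> = ?Z \<omega>"
    by (rule real_cond_exp_F_meas[OF Z Z_F])
  moreover have "AE \<omega> in M. real_cond_exp M (F t) ?W \<omega> = noise_var"
    using real_cond_exp_indep[OF F_indep space_F space_generated_by W_gen W(1)] W(2) by simp
  ultimately show ?thesis by eventually_elim simp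
qed

lemma increment_bound:
  "\<exists>B1. integrable M B1 \<and> (\<forall>\<omega>\<in>space M. B1 \<omega> > 0) \<and>
     (\<forall>t. integrable M (\<lambda>\<omega>. (norm (mean_path J z (Suc t) \<omega> - mean_path J z t \<omega>))\<^sup>2) \<and>
       (AE \<omega> in M. real_cond_exp M (F t)
           (\<lambda>\<omega>. (norm (mean_path J z (Suc t) \<omega> - mean_path J z t \<omega>))\<^sup>2) \<omega>
         \<le> B1 \<omega> / (real t + 1)\<^sup>2))"
proof -
  obtain Y where Y: "integrable M Y" "\<forall>\<omega>. 0 \<le> Y \<omega>"
      "AE \<omega> in M. \<forall>t. (norm (mean_path J z t \<omega>))\<^sup>2 \<le> Y \<omega>"
    using mean_dominated by blast
  let ?B = "\<lambda>\<omega>. increment_const * (Y \<omega> + 1 + noise_var)"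
  have var: "0 \<le> noise_var"
    unfolding noise_var_def by (rule Bochner_Integration.integral_nonneg) simp
  have "AE \<omega> in M. real_cond_exp M (F t)
      (\<lambda>\<omega>. (norm (mean_path J z (Suc t) \<omega> - mean_path J z t \<omega>))\<^sup>2) \<omega> \<le> ?B \<omega> / (real t + 1)\<^sup>2" for t
    using AE_cond_exp_increment_le[of t] Y(3)
  proof eventually_elim
    case (elim \<omega>)
    have "increment_const / (real t + 1)\<^sup>2 * ((norm (mean_path J z t \<omega>))\<^sup>2 + 1 + noise_var)
        \<le> increment_const / (real t + 1)\<^sup>2 * (Y \<omega> + 1 + noise_var)"
      using elim increment_const_pos by (intro mult_left_mono) auto
    with elim show ?case by simp
  qed
  moreover have "0 < ?B \<omega>" for \<omega>
    using increment_const_pos var Y(2) by (intro mult_pos_pos) (auto simp: add_nonneg_pos add_pos_nonneg)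
  ultimately show ?thesis
    using Y(1) increment_integrable by (intro exI[of _ ?B]) auto
qed

lemma second_moment_bound:
  "\<exists>B2>0. \<forall>t\<ge>1. integrable M (\<lambda>\<omega>. (norm (mean_path J z t \<omega>))\<^sup>2) \<and>
     integrable M (\<lambda>\<omega>. (norm (mean_path J z t \<omega> - zs))\<^sup>2) \<and>
     max (\<integral>\<omega>. (norm (mean_path J z t \<omega>))\<^sup>2 \<partial>M) (\<integral>\<omega>. (norm (mean_path J z t \<omega> - zs))\<^sup>2 \<partial>M)
       \<le> B2 * (1 + ln (real t))"
proof -
  obtain Y where Y: "integrable M Y" "\<forall>\<omega>. 0 \<le> Y \<omega>"
      "AE \<omega> in M. \<forall>t. (norm (mean_path J z t \<omega>))\<^sup>2 \<le> Y \<omega>"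
    using mean_dominated by blast
  define B where "B = 2 * expectation Y + 2 * (norm zs)\<^sup>2 + 1"
  have EY: "0 \<le> expectation Y" using Y(2) by simp
  have sq2: "(norm (x - y))\<^sup>2 \<le> 2 * (norm x)\<^sup>2 + 2 * (norm y)\<^sup>2" for x y :: "real^'d"
  proof -
    have "(norm (x - y))\<^sup>2 \<le> (norm x + norm y)\<^sup>2"
      by (intro power_mono norm_triangle_ineq4) auto
    also have "\<dots> \<le> 2 * (norm x)\<^sup>2 + 2 * (norm y)\<^sup>2"
      using zero_le_power2[of "norm x - norm y"] unfolding power2_diff power2_sum by linarith
    finally show ?thesis .
  qed
  have int: "integrable M (\<lambda>\<omega>. (norm (mean_path J z t \<omega> - zs))\<^sup>2)" for t
  proof (rule Bochner_Integration.integrable_bound)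
    show "integrable M (\<lambda>\<omega>. 2 * (norm (mean_path J z t \<omega>))\<^sup>2 + 2 * (norm zs)\<^sup>2)"
      using mean_square_integrable by simp
    show "AE \<omega> in M. norm ((norm (mean_path J z t \<omega> - zs))\<^sup>2)
        \<le> norm (2 * (norm (mean_path J z t \<omega>))\<^sup>2 + 2 * (norm zs)\<^sup>2)"
      using sq2 by simp
  qed measurable
  have E1: "expectation (\<lambda>\<omega>. (norm (mean_path J z t \<omega>))\<^sup>2) \<le> expectation Y" for t
  proof (rule integral_mono_AE[OF mean_square_integrable Y(1)])
    show "AE \<omega> in M. (norm (mean_path J z t \<omega>))\<^sup>2 \<le> Y \<omega>"
      using Y(3) by eventually_elim simp
  qed
  have "expectation (\<lambda>\<omega>. (norm (mean_path J z t \<omega> - zs))\<^sup>2)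
      \<le> expectation (\<lambda>\<omega>. 2 * (norm (mean_path J z t \<omega>))\<^sup>2 + 2 * (norm zs)\<^sup>2)" for t
    using mean_square_integrable by (intro integral_mono int sq2) auto
  also have "expectation (\<lambda>\<omega>. 2 * (norm (mean_path J z t \<omega>))\<^sup>2 + 2 * (norm zs)\<^sup>2)
      = 2 * expectation (\<lambda>\<omega>. (norm (mean_path J z t \<omega>))\<^sup>2) + 2 * (norm zs)\<^sup>2" for t
    using mean_square_integrable by (simp add: prob_space)
  finally have E2: "expectation (\<lambda>\<omega>. (norm (mean_path J z t \<omega> - zs))\<^sup>2)
      \<le> 2 * expectation (\<lambda>\<omega>. (norm (mean_path J z t \<omega>))\<^sup>2) + 2 * (norm zs)\<^sup>2" for t .
  have "max (expectation (\<lambda>\<omega>. (norm (mean_path J z t \<omega>))\<^sup>2))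
      (expectation (\<lambda>\<omega>. (norm (mean_path J z t \<omega> - zs))\<^sup>2)) \<le> B * (1 + ln (real t))" if "1 \<le> t" for t
  proof -
    have "max (expectation (\<lambda>\<omega>. (norm (mean_path J z t \<omega>))\<^sup>2))
        (expectation (\<lambda>\<omega>. (norm (mean_path J z t \<omega> - zs))\<^sup>2)) \<le> B * 1"
      using E1[of t] E2[of t] EY zero_le_power2[of "norm zs"] unfolding B_def mult_1_right
      by (intro max.boundedI) linarith+
    also have "\<dots> \<le> B * (1 + ln (real t))"
      using that EY by (intro mult_left_mono) (auto simp: B_def)
    finally show ?thesis .
  qed
  moreover have "0 < B" using EY by (simp add: B_def add_nonneg_pos)
  ultimately show ?thesis using mean_square_integrable int by blast
qed

end

theorem lemma3p3:
  fixes M :: "'a measure"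
    and S :: "nat \<Rightarrow> 'a \<Rightarrow> real^'d^'p"
    and w :: "nat \<Rightarrow> 'a \<Rightarrow> real^'p"
    and zs :: "real^'d"
    and \<Gamma> :: "real^'p^'p"
    and z :: "nat \<Rightarrow> nat \<Rightarrow> 'a \<Rightarrow> real^'d"
    and J :: nat
    and Amax \<alpha> h \<sigma>\<^sub>l :: real
  defines "u \<equiv> obs S w zs"
  defines "F \<equiv> obs_filtration M S u"
  assumes model: "observation_model M S w zs \<Gamma> Amax"
    and J: "J \<ge> 1"
    and \<alpha>: "\<alpha> > 0"
    and h: "h > 0"
    and dyn: "deki M J \<alpha> (\<lambda>_. h) S u z"
    and \<sigma>\<^sub>l: "\<sigma>\<^sub>l > 0"
    and init: "AE \<omega> in M. ens_cov J (\<lambda>j. z 0 j \<omega>) \<succ>\<^sub>L \<sigma>\<^sub>l *\<^sub>R mat 1"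
    and step: "AE \<omega> in M. h \<le> min (\<alpha> / (real J * (Amax + \<alpha>)\<^sup>2)) (real J / \<alpha>)
                                  * inverse (ens_spread J (\<lambda>j. z 0 j \<omega>))"
  shows "(\<exists>B1. integrable M B1 \<and> (\<forall>\<omega>\<in>space M. B1 \<omega> > 0) \<and>
            (\<forall>t. integrable M (\<lambda>\<omega>. (norm (mean_path J z (Suc t) \<omega> - mean_path J z t \<omega>))\<^sup>2) \<and>
                 (AE \<omega> in M.
                    real_cond_exp M (F t)
                      (\<lambda>\<omega>. (norm (mean_path J z (Suc t) \<omega> - mean_path J z t \<omega>))\<^sup>2) \<omega>
                    \<le> B1 \<omega> / (real t + 1)\<^sup>2)))
       \<and> (\<exists>B2>0. \<forall>t\<ge>1.
            integrable M (\<lambda>\<omega>. (norm (mean_path J z t \<omega>))\<^sup>2) \<and>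
            integrable M (\<lambda>\<omega>. (norm (mean_path J z t \<omega> - zs))\<^sup>2) \<and>
            max (\<integral>\<omega>. (norm (mean_path J z t \<omega>))\<^sup>2 \<partial>M)
                (\<integral>\<omega>. (norm (mean_path J z t \<omega> - zs))\<^sup>2 \<partial>M)
              \<le> B2 * (1 + ln (real t)))"
proof -
  interpret deki_process M S w zs \<Gamma> z J Amax \<alpha> h \<sigma>\<^sub>l
    using assms(3-) unfolding u_def by unfold_locales
  show ?thesis
    unfolding F_def u_def using increment_bound second_moment_bound by (rule conjI)
qed

end
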